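(* Let $\mathcal C$ be a $Q$-polynomial coherent configuration with fibers $X_1,\dots,X_n$, relations $R^{(i,j)}_\ell$ ($\varepsilon_{i,j}\le\ell\le r_{i,j}$) and basis $\{E^{(i,j)}_\ell\}$ as in the definition. For each $i$ let $Y_i\subseteq X_i$ be a $t_i$-design in the $Q$-polynomial association scheme on $X_i$ (which has $d_i=r_{i,i}$ classes). Let $s_{i,j}=|\{\ell\in\{1,\dots,r_{i,j}\}: R^{(i,j)}_\ell\cap(Y_i\times Y_j)\neq\emptyset\}|$. If $s_{i,j}+s_{j,h}-2\le t_j$ for all $i,j,h\in\{1,\dots,n\}$, then $\bigcup_{i=1}^nY_i$ with the relations $\{(x,x):x\in Y_i\}$ ($1\le i\le n$) and the nonempty sets $R^{(i,j)}_\ell\cap(Y_i\times Y_j)$ ($1\le i,j\le n$, $1\le\ell\le r_{i,j}$) is a $Q$-polynomial coherent configuration.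
   Context: Coherent configuration: pair $(X,\mathcal R)$, $\mathcal R$ a partition of $X\times X$ into nonempty relations, closed under transpose, each relation meeting the diagonal contained in it, and $|\{z:(x,z)\in R,(z,y)\in R'\}|$ constant on each relation $R''$. Its fibers $X_i$ are given by the diagonal relations; relations in $X_i\times X_j$ are labelled $R^{(i,j)}_\ell$, $\varepsilon_{i,j}\le\ell\le r_{i,j}$ ($\varepsilon_{i,j}=1-\delta_{i,j}$, $R^{(i,i)}_0$ diagonal, $(R^{(i,j)}_\ell)^\top=R^{(j,i)}_\ell$), $\tilde r_{i,j}=r_{i,j}-\varepsilon_{i,j}$, $A^{(i,j)}_\ell$ adjacency matrices, $\mathcal A^{(i,j)}$ their span, $\mathcal A$ the span of all. It is a $Q$-polynomial coherent configuration if each fiber $(X_i,\{R^{(i,i)}_\ell\})$ is a symmetric association scheme and there is a basis $\{E^{(i,j)}_\ell: 0\le\ell\le\tilde r_{i,j}\}$ of $\mathcal A$ with (B1) $E^{(i,j)}_0=\frac{1}{\sqrt{|X_i||X_j|}}\times$(all-ones on $X_i\times X_j$, zero elsewhere); (B2) $\{E^{(i,j)}_\ell\}_\ell$ is a basis of $\mathcal A^{(i,j)}$; (B3) $(E^{(i,j)}_\ell)^\top=E^{(j,i)}_\ell$; (B4) $E^{(i,j)}_\ell E^{(i',j')}_{\ell'}=\delta_{\ell,\ell'}\delta_{j,i'}E^{(i,j')}_\ell$; and such that, writing $E^{(i,j)}_\ell\circ E^{(i,j)}_m=\frac{1}{\sqrt{|X_i||X_j|}}\sum_nq^{(i,j)}_{\ell,m,n}E^{(i,j)}_n$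 ($\circ$ entrywise product), every matrix $(q^{(i,j)}_{1,m,n})_{m,n=0}^{\tilde r_{i,j}}$ is tridiagonal with nonzero super- and subdiagonal entries. In particular each fiber $X_i$ is a $Q$-polynomial association scheme with respect to the ordering $E^{(i,i)}_0,\dots,E^{(i,i)}_{r_{i,i}}$ of its primitive idempotents, and a $t$-design in it is a nonempty $Y\subseteq X_i$ with $E^{(i,i)}_\ell\chi_Y=0$ for $1\le\ell\le t$, $\chi_Y$ the characteristic vector of $Y$. *)

theory Defs
  imports "HOL-Analysis.Analysis" "HOL-Library.Disjoint_Sets"
begin

text \<open>
  The underlying set \<open>X\<close> of a configuration is a set in a finite type \<open>'a\<close>, and a matrix indexed by
  \<open>X\<close> (or by a block \<open>X\<^sub>i \<times> X\<^sub>j\<close>) is an element of \<open>real^'a^'a\<close> that vanishes outside the block.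
  This lets a configuration and one carried by a subset of \<open>X\<close> live in the same matrix space.
\<close>

definition adjacency_matrix :: "('a::finite \<times> 'a) set \<Rightarrow> real^'a^'a" where
  "adjacency_matrix S = (\<chi> x y. if (x, y) \<in> S then 1 else 0)"

definition char_vec :: "'a::finite set \<Rightarrow> real^'a" where
  "char_vec Y = (\<chi> x. if x \<in> Y then 1 else 0)"

definition hadamard :: "real^'a^'a \<Rightarrow> real^'a^'a \<Rightarrow> real^'a^'a::finite" where
  "hadamard A B = (\<chi> x y. A $ x $ y * B $ x $ y)"

definition indexed_basis :: "('i \<Rightarrow> 'v::real_vector) \<Rightarrow> 'i set \<Rightarrow> 'v set \<Rightarrow> bool" where
  "indexed_basis b I V \<longleftrightarrow> inj_on b I \<and> independent (b ` I) \<and> span (b ` I) = V"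


definition coherent_configuration :: "'a set \<Rightarrow> ('a \<times> 'a) set set \<Rightarrow> bool" where
  "coherent_configuration X \<R> \<longleftrightarrow>
     finite X \<and> X \<noteq> {} \<and>
     partition_on (X \<times> X) \<R> \<and>
     (\<forall>S\<in>\<R>. S\<inverse> \<in> \<R>) \<and>
     (\<forall>S\<in>\<R>. S \<inter> Id_on X \<noteq> {} \<longrightarrow> S \<subseteq> Id_on X) \<and>
     (\<forall>S\<in>\<R>. \<forall>T\<in>\<R>. \<forall>U\<in>\<R>. \<exists>p. \<forall>(x, y)\<in>U. card {z \<in> X. (x, z) \<in> S \<and> (z, y) \<in> T} = p)"

definition fibers :: "('a \<times> 'a) set set \<Rightarrow> 'a set set" where
  "fibers \<R> = {F. Id_on F \<in> \<R>}"

definition symmetric_association_scheme ::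
  "'a set \<Rightarrow> nat \<Rightarrow> (nat \<Rightarrow> ('a \<times> 'a) set) \<Rightarrow> bool" where
  "symmetric_association_scheme X d R \<longleftrightarrow>
     finite X \<and> X \<noteq> {} \<and>
     inj_on R {0..d} \<and> partition_on (X \<times> X) (R ` {0..d}) \<and>
     R 0 = Id_on X \<and>
     (\<forall>l\<in>{0..d}. (R l)\<inverse> = R l) \<and>
     (\<forall>k\<in>{0..d}. \<forall>l\<in>{0..d}. \<forall>m\<in>{0..d}.
        \<exists>p. \<forall>(x, y)\<in>R m. card {z \<in> X. (x, z) \<in> R k \<and> (z, y) \<in> R l} = p)"

definition eps :: "nat \<Rightarrow> nat \<Rightarrow> nat" where
  "eps i j = (if i = j then 0 else 1)"

text \<open>
  The fibers are \<open>F 1, \<dots>, F n\<close>, and the relations inside \<open>F i \<times> F j\<close> are \<open>R i j l\<close> for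
  \<open>eps i j \<le> l \<le> r i j\<close>. The values \<open>R i j l\<close> for other \<open>l\<close> are irrelevant.
\<close>

definition cc_labelling ::
  "('a \<times> 'a) set set \<Rightarrow> nat \<Rightarrow> (nat \<Rightarrow> 'a set) \<Rightarrow> (nat \<Rightarrow> nat \<Rightarrow> nat)
     \<Rightarrow> (nat \<Rightarrow> nat \<Rightarrow> nat \<Rightarrow> ('a \<times> 'a) set) \<Rightarrow> bool" where
  "cc_labelling \<R> n F r R \<longleftrightarrow>
     bij_betw F {1..n} (fibers \<R>) \<and>
     (\<forall>i\<in>{1..n}. R i i 0 = Id_on (F i)) \<and>
     (\<forall>i\<in>{1..n}. \<forall>j\<in>{1..n}.
        bij_betw (R i j) {eps i j..r i j} {S \<in> \<R>. S \<subseteq> F i \<times> F j} \<and>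
        r j i = r i j \<and>
        (\<forall>l\<in>{eps i j..r i j}. (R i j l)\<inverse> = R j i l))"

definition r_tilde :: "(nat \<Rightarrow> nat \<Rightarrow> nat) \<Rightarrow> nat \<Rightarrow> nat \<Rightarrow> nat" where
  "r_tilde r i j = r i j - eps i j"

definition coherent_algebra :: "('a \<times> 'a) set set \<Rightarrow> (real^'a^'a::finite) set" where
  "coherent_algebra \<R> = span (adjacency_matrix ` \<R>)"

definition block_space ::
  "(nat \<Rightarrow> nat \<Rightarrow> nat) \<Rightarrow> (nat \<Rightarrow> nat \<Rightarrow> nat \<Rightarrow> ('a \<times> 'a) set) \<Rightarrow> nat \<Rightarrow> nat
     \<Rightarrow> (real^'a^'a::finite) set" where
  "block_space r R i j = span ((\<lambda>l. adjacency_matrix (R i j l)) ` {eps i j..r i j})"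

text \<open>
  In \<open>QB4\<close>, the product formula tacitly says that \<open>E i j' l\<close> exists,
  that is \<open>l \<le> r_tilde r i j'\<close>, whenever \<open>E i j l\<close> and \<open>E j j' l\<close> do; this is spelled out.
  Real scalars are no restriction: as all fibers are symmetric, a complex family with the
  properties \<open>QB1\<close> to \<open>QB4\<close> has real entries.
\<close>

definition QB1 where
  "QB1 n F E \<longleftrightarrow> (\<forall>i\<in>{1..n}. \<forall>j\<in>{1..n}.
     E i j (0::nat) = (1 / sqrt (real (card (F i)) * real (card (F j)))) *\<^sub>R
                 adjacency_matrix (F i \<times> F j))"

definition QB2 where
  "QB2 n r R E \<longleftrightarrow> (\<forall>i\<in>{1..n}. \<forall>j\<in>{1..n}.
     indexed_basis (E i j) {0..r_tilde r i j} (block_space r R i j))"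

definition QB3 where
  "QB3 n r E \<longleftrightarrow> (\<forall>i\<in>{1..n}. \<forall>j\<in>{1..n}. \<forall>l\<in>{0..r_tilde r i j}.
     transpose (E i j l) = E j i l)"

definition QB4 ::
  "nat \<Rightarrow> (nat \<Rightarrow> nat \<Rightarrow> nat) \<Rightarrow> (nat \<Rightarrow> nat \<Rightarrow> nat \<Rightarrow> real^'a^'a::finite) \<Rightarrow> bool" where
  "QB4 n r E \<longleftrightarrow> (\<forall>i\<in>{1..n}. \<forall>j\<in>{1..n}. \<forall>i'\<in>{1..n}. \<forall>j'\<in>{1..n}.
     \<forall>l\<in>{0..r_tilde r i j}. \<forall>l'\<in>{0..r_tilde r i' j'}.
       if l = l' \<and> j = i' then l \<le> r_tilde r i j' \<and> E i j l ** E i' j' l' = E i j' l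
       else E i j l ** E i' j' l' = 0)"

definition krein_parameters ::
  "nat \<Rightarrow> (nat \<Rightarrow> 'a::finite set) \<Rightarrow> (nat \<Rightarrow> nat \<Rightarrow> nat) \<Rightarrow> (nat \<Rightarrow> nat \<Rightarrow> nat \<Rightarrow> real^'a^'a)
     \<Rightarrow> (nat \<Rightarrow> nat \<Rightarrow> nat \<Rightarrow> nat \<Rightarrow> nat \<Rightarrow> real) \<Rightarrow> bool" where
  "krein_parameters n F r E q \<longleftrightarrow> (\<forall>i\<in>{1..n}. \<forall>j\<in>{1..n}.
     \<forall>l\<in>{0..r_tilde r i j}. \<forall>m\<in>{0..r_tilde r i j}.
       hadamard (E i j l) (E i j m) =
         (1 / sqrt (real (card (F i)) * real (card (F j)))) *\<^sub>R
         (\<Sum>k = 0..r_tilde r i j. q i j l m k *\<^sub>R E i j k))"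

definition irreducible_tridiagonal :: "(nat \<Rightarrow> nat \<Rightarrow> real) \<Rightarrow> nat \<Rightarrow> bool" where
  "irreducible_tridiagonal M d \<longleftrightarrow> (\<forall>m\<in>{0..d}. \<forall>k\<in>{0..d}.
     (m + 1 < k \<or> k + 1 < m \<longrightarrow> M m k = 0) \<and>
     (k = m + 1 \<or> m = k + 1 \<longrightarrow> M m k \<noteq> 0))"

text \<open>
  The Krein parameters are determined by \<open>E\<close> because each block family is a basis. If
  \<open>r_tilde r i j = 0\<close> there is no \<open>E i j 1\<close>, and the tridiagonality condition, about a
  one-by-one matrix, holds vacuously.
\<close>

definition Q_polynomial_data ::
  "'a::finite set \<Rightarrow> ('a \<times> 'a) set set \<Rightarrow> nat \<Rightarrow> (nat \<Rightarrow> 'a set) \<Rightarrow> (nat \<Rightarrow> nat \<Rightarrow> nat)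
     \<Rightarrow> (nat \<Rightarrow> nat \<Rightarrow> nat \<Rightarrow> ('a \<times> 'a) set)
     \<Rightarrow> (nat \<Rightarrow> nat \<Rightarrow> nat \<Rightarrow> real^'a^'a) \<Rightarrow> bool" where
  "Q_polynomial_data X \<R> n F r R E \<longleftrightarrow>
     coherent_configuration X \<R> \<and>
     cc_labelling \<R> n F r R \<and>
     (\<forall>i\<in>{1..n}. symmetric_association_scheme (F i) (r i i) (R i i)) \<and>
     indexed_basis (\<lambda>(i, j, l). E i j l)
       {(i, j, l). i \<in> {1..n} \<and> j \<in> {1..n} \<and> l \<in> {0..r_tilde r i j}} (coherent_algebra \<R>) \<and>
     QB1 n F E \<and> QB2 n r R E \<and> QB3 n r E \<and> QB4 n r E \<and>
     (\<exists>q. krein_parameters n F r E q \<and>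
        (\<forall>i\<in>{1..n}. \<forall>j\<in>{1..n}. irreducible_tridiagonal (q i j 1) (r_tilde r i j)))"

definition Q_polynomial_coherent_configuration ::
  "'a::finite set \<Rightarrow> ('a \<times> 'a) set set \<Rightarrow> bool" where
  "Q_polynomial_coherent_configuration X \<R> \<longleftrightarrow> (\<exists>n F r R E. Q_polynomial_data X \<R> n F r R E)"

text \<open>
  A \<open>t\<close>-design in a \<open>Q\<close>-polynomial scheme on \<open>X\<close> with \<open>d\<close> classes and ordered primitive
  idempotents \<open>E 0, \<dots>, E d\<close>. For \<open>t > d\<close> only the existing idempotents impose a condition.
\<close>

definition t_design ::
  "'a::finite set \<Rightarrow> nat \<Rightarrow> (nat \<Rightarrow> real^'a^'a) \<Rightarrow> nat \<Rightarrow> 'a set \<Rightarrow> bool" where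
  "t_design X d E t Y \<longleftrightarrow>
     Y \<noteq> {} \<and> Y \<subseteq> X \<and> (\<forall>l. 1 \<le> l \<and> l \<le> t \<and> l \<le> d \<longrightarrow> E l *v char_vec Y = 0)"

definition degree_between ::
  "(nat \<Rightarrow> nat \<Rightarrow> nat) \<Rightarrow> (nat \<Rightarrow> nat \<Rightarrow> nat \<Rightarrow> ('a \<times> 'a) set) \<Rightarrow> (nat \<Rightarrow> 'a set)
     \<Rightarrow> nat \<Rightarrow> nat \<Rightarrow> nat" where
  "degree_between r R Y i j = card {l \<in> {1..r i j}. R i j l \<inter> (Y i \<times> Y j) \<noteq> {}}"

definition induced_relations ::
  "nat \<Rightarrow> (nat \<Rightarrow> nat \<Rightarrow> nat) \<Rightarrow> (nat \<Rightarrow> nat \<Rightarrow> nat \<Rightarrow> ('a \<times> 'a) set) \<Rightarrow> (nat \<Rightarrow> 'a set)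
     \<Rightarrow> ('a \<times> 'a) set set" where
  "induced_relations n r R Y =
     {Id_on (Y i) | i. i \<in> {1..n}} \<union>
     {R i j l \<inter> (Y i \<times> Y j) | i j l. i \<in> {1..n} \<and> j \<in> {1..n} \<and> l \<in> {1..r i j} \<and>
                                   R i j l \<inter> (Y i \<times> Y j) \<noteq> {}}"

end

theory Submission
  imports Defs
begin

text \<open>
  Cut the basis matrices \<open>E i j l\<close> down to \<open>Y i \<times> Y j\<close> and scale them by
  \<open>sqrt (\<bar>F i\<bar> \<bar>F j\<bar> / (\<bar>Y i\<bar> \<bar>Y j\<bar>))\<close>, obtaining \<open>H i j l\<close>. If \<open>l + m \<le> t j\<close>, the design property of
  \<open>Y j\<close> makes the product of \<open>H i j l\<close> and \<open>H j h m\<close> the same as before the restriction, namely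
  \<open>H i h l\<close> or \<open>0\<close>. By hypothesis this covers all \<open>l < s i j\<close> and \<open>m < s j h\<close>, which for
  \<open>i \<noteq> j\<close> is already as many matrices as there are relations between \<open>Y i\<close> and \<open>Y j\<close>. For \<open>i = j\<close>
  one more is needed, and the identity minus the sum of the \<open>H i i k\<close> with \<open>k < s i i\<close> serves.
  It is nonzero since \<open>E i i k\<close> is a polynomial of degree \<open>k\<close> in \<open>E i i 1\<close> (entrywise) and \<open>E i i 1\<close>
  separates the relations: a combination of degree less than \<open>s i i\<close> that vanishes on all \<open>s i i\<close>
  nondiagonal relations is zero. Products of these matrices being again in their span, the restricted
  relations form a coherent configuration. The new Krein matrices inherit their entries from the old
  ones except in the last rows, which the symmetry of the Krein parameters determines.
\<close>

section \<open>Matrices and polynomials\<close>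

text \<open>A linear map that vanishes on all other members but not on a given one keeps the latter
  out of their span. The target space is arbitrary, so that multiplication by a matrix can serve as
  the separating map.\<close>

lemma independent_familyI:
  fixes f :: "'i \<Rightarrow> 'v::real_vector"
  assumes "\<And>i. i \<in> I \<Longrightarrow>
    \<exists>\<phi> :: 'v \<Rightarrow> 'w::real_vector. linear \<phi> \<and> \<phi> (f i) \<noteq> 0 \<and> (\<forall>j\<in>I - {i}. \<phi> (f j) = 0)"
  shows "inj_on f I" and "independent (f ` I)"
proof -
  show inj: "inj_on f I"
    using assms by (metis (no_types, lifting) DiffI inj_onI singletonD)
  have "f i \<notin> span (f ` I - {f i})" if i: "i \<in> I" for i
  proof
    assume a: "f i \<in> span (f ` I - {f i})"
    obtain \<phi> :: "'v \<Rightarrow> 'w" where \<phi>: "linear \<phi>" "\<phi> (f i) \<noteq> 0" "\<And>j. j \<in> I - {i} \<Longrightarrow> \<phi> (f j) = 0"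
      using assms[OF i] by blast
    have "f ` I - {f i} \<subseteq> {v. \<phi> v = 0}" using \<phi> by auto
    moreover have "subspace {v. \<phi> v = 0}" using \<phi>(1) by (rule linear_subspace_kernel)
    ultimately have "span (f ` I - {f i}) \<subseteq> {v. \<phi> v = 0}" by (rule span_minimal)
    then show False using a \<phi>(2) by auto
  qed
  then show "independent (f ` I)" by (auto simp: dependent_def)
qed

lemma in_span_image_finiteD:
  fixes f :: "'i \<Rightarrow> 'v::real_vector"
  assumes "finite I" "inj_on f I" "v \<in> span (f ` I)"
  obtains c where "v = (\<Sum>i\<in>I. c i *\<^sub>R f i)"
proof -
  obtain u where "v = (\<Sum>w\<in>f ` I. u w *\<^sub>R w)"
    using assms span_finite[of "f ` I"] by auto
  then have "v = (\<Sum>i\<in>I. (u \<circ> f) i *\<^sub>R f i)" using assms(2) by (simp add: sum.reindex)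
  then show thesis by (rule that)
qed

section \<open>Matrix products, entrywise products and the trace form\<close>

lemma matrix_mul_nth: "(A ** B) $ x $ y = (\<Sum>z\<in>UNIV. A $ x $ z * B $ z $ y)"
  by (simp add: matrix_matrix_mult_def)

lemma matrix_mul_zero [simp]: "(0::real^'a^'a) ** A = 0" "A ** (0::real^'a^'a::finite) = 0"
  by (simp_all add: matrix_matrix_mult_def vec_eq_iff)

lemma linear_matrix_mul_left: "linear (\<lambda>M::real^'a^'a::finite. A ** M)"
  by (rule linearI)
    (simp_all add: matrix_add_ldistrib vec_eq_iff matrix_mul_nth sum_distrib_left algebra_simps)

lemma linear_matrix_mul_right: "linear (\<lambda>M::real^'a^'a::finite. M ** A)"
  by (rule linearI)
    (simp_all add: vec_eq_iff matrix_mul_nth sum_distrib_left sum.distrib algebra_simps)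

lemma linear_hadamard: "linear (hadamard A)"
  by (rule linearI) (simp_all add: hadamard_def vec_eq_iff algebra_simps)

lemma hadamard_commute: "hadamard A B = hadamard B A"
  by (simp add: hadamard_def mult.commute)

lemma hadamard_inner_swap: "hadamard A B \<bullet> C = hadamard A C \<bullet> B"
  by (simp add: hadamard_def inner_vec_def algebra_simps)

text \<open>The inner product of \<open>real^'a^'a\<close> is the trace of
  \<open>A ** transpose B\<close>.\<close>

lemma inner_matrix_eq_0I:
  fixes A B :: "real^'a^'a::finite"
  assumes "A ** transpose B = 0"
  shows "A \<bullet> B = 0"
proof -
  have "A \<bullet> B = (\<Sum>x\<in>UNIV. (A ** transpose B) $ x $ x)"
    by (simp add: inner_vec_def matrix_mul_nth transpose_def)
  then show ?thesis using assms by simp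
qed

lemma span_mul_closed:
  fixes \<S> \<T> \<U> :: "(real^'a^'a::finite) set"
  assumes "\<And>S T. S \<in> \<S> \<Longrightarrow> T \<in> \<T> \<Longrightarrow> S ** T \<in> span \<U>"
    and "A \<in> span \<S>" "B \<in> span \<T>"
  shows "A ** B \<in> span \<U>"
proof -
  have 1: "S ** B \<in> span \<U>" if "S \<in> \<S>" for S
    using assms(3)
  proof (induction rule: span_induct)
    show "subspace {B. S ** B \<in> span \<U>}"
      using subspace_span linear_subspace_vimage[OF linear_matrix_mul_left, of "span \<U>" S]
      by (simp add: vimage_def)
  qed (use assms(1) that in auto)
  show ?thesis using assms(2)
  proof (induction rule: span_induct)
    show "subspace {A. A ** B \<in> span \<U>}"
      using subspace_span linear_subspace_vimage[OF linear_matrix_mul_right, of "span \<U>" B]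
      by (simp add: vimage_def)
  qed (use 1 in auto)
qed

lemma matrix_mul_Id_on:
  fixes M :: "real^'a^'a::finite"
  assumes "\<And>x y. y \<notin> B \<Longrightarrow> M $ x $ y = 0"
  shows "M ** adjacency_matrix (Id_on B) = M"
proof -
  have "(M ** adjacency_matrix (Id_on B)) $ x $ y = M $ x $ y" for x y
  proof -
    have "(M ** adjacency_matrix (Id_on B)) $ x $ y =
        (\<Sum>z\<in>UNIV. if z = y then M $ x $ z * (if y \<in> B then 1 else 0) else 0)"
      unfolding matrix_mul_nth adjacency_matrix_def by (intro sum.cong) auto
    then show ?thesis using assms[of y x] by simp
  qed
  then show ?thesis by (simp add: vec_eq_iff)
qed

text \<open>Expand \<open>I\<close> in the \<open>P k\<close> with coefficients \<open>c k\<close>.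
  Multiplying by \<open>P k\<close> on the left gives \<open>P k = c k *\<^sub>R P k\<close>, so
  every \<open>c k\<close> is 1.\<close>

lemma sum_orthogonal_idempotents:
  fixes P :: "nat \<Rightarrow> real^'a^'a::finite"
  assumes mult: "\<And>k m. k \<le> d \<Longrightarrow> m \<le> d \<Longrightarrow> P k ** P m = (if k = m then P k else 0)"
    and nz: "\<And>k. k \<le> d \<Longrightarrow> P k \<noteq> 0" and unit: "\<And>k. k \<le> d \<Longrightarrow> P k ** I = P k"
    and I: "I \<in> span (P ` {..d})"
  shows "(\<Sum>k\<le>d. P k) = I"
proof -
  have "inj_on P {..d}" by (rule inj_onI) (metis atMost_iff mult nz)
  then obtain c where c: "I = (\<Sum>k\<le>d. c k *\<^sub>R P k)" using in_span_image_finiteD[OF _ _ I] by blast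
  have "c k = 1" if k: "k \<le> d" for k
  proof -
    have "P k = P k ** I" using unit[OF k] by simp
    also have "\<dots> = (\<Sum>m\<le>d. c m *\<^sub>R (P k ** P m))"
      unfolding c linear_sum[OF linear_matrix_mul_left] linear_cmul[OF linear_matrix_mul_left] by (rule refl)
    also have "\<dots> = (\<Sum>m\<le>d. if m = k then c k *\<^sub>R P k else 0)"
      by (intro sum.cong refl) (simp add: mult[OF k])
    finally have eq: "P k = c k *\<^sub>R P k" using k by simp
    have "(c k - 1) *\<^sub>R P k = 0" using eq by (simp only: scaleR_diff_left scaleR_one diff_self)
    then show ?thesis using nz[OF k] by simp
  qed
  then have "(\<Sum>k\<le>d. c k *\<^sub>R P k) = (\<Sum>k\<le>d. P k)" by (intro sum.cong) simp_all
  then show ?thesis using c by metis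
qed

text \<open>If \<open>d\<close> is the largest index with a nonzero coefficient, no other summand
  contributes to the coefficient of degree \<open>d\<close>.\<close>

lemma distinct_degrees_independent:
  fixes P :: "nat \<Rightarrow> 'b::idom poly"
  assumes "finite K" and P: "\<And>k. k \<in> K \<Longrightarrow> P k \<noteq> 0 \<and> degree (P k) = k"
    and sum: "(\<Sum>k\<in>K. smult (c k) (P k)) = 0" and "k \<in> K"
  shows "c k = 0"
proof (rule ccontr)
  assume "c k \<noteq> 0"
  define N where "N = {k \<in> K. c k \<noteq> 0}"
  define d where "d = Max N"
  have N: "finite N" "N \<noteq> {}" using \<open>finite K\<close> \<open>k \<in> K\<close> \<open>c k \<noteq> 0\<close> by (auto simp: N_def)
  have d: "d \<in> K" "c d \<noteq> 0" using Max_in[OF N] by (auto simp: d_def N_def)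
  have others: "coeff (smult (c m) (P m)) d = 0" if m: "m \<in> K - {d}" for m
  proof (cases "c m = 0")
    case False
    then have "m < d" using Max_ge[OF N(1), of m] m by (auto simp: d_def N_def)
    then show ?thesis using P[of m] m by (simp add: coeff_eq_0)
  qed simp
  have "(\<Sum>m\<in>K. coeff (smult (c m) (P m)) d) = (\<Sum>m\<in>{d}. coeff (smult (c m) (P m)) d)"
    using \<open>finite K\<close> d(1) others by (intro sum.mono_neutral_right) auto
  then have "c d * coeff (P d) d = 0" using arg_cong[OF sum, of "\<lambda>p. coeff p d"] by (simp add: coeff_sum)
  then show False using P[OF d(1)] d(2) by (metis leading_coeff_0_iff mult_eq_0_iff)
qed

section \<open>Bases of partitioned matrix algebras\<close>

text \<open>Intersection numbers are left out on purpose: the locale has to fit the relations cut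
  down to the designs before these are known to be coherent. Coherence is later derived from a
  basis.\<close>

locale labelled_partition =
  fixes n :: nat and Y :: "nat \<Rightarrow> 'a::finite set" and s :: "nat \<Rightarrow> nat \<Rightarrow> nat"
    and S :: "nat \<Rightarrow> nat \<Rightarrow> nat \<Rightarrow> ('a \<times> 'a) set"
  assumes n_pos: "n \<ge> 1"
    and fiber_nonempty: "i \<in> {1..n} \<Longrightarrow> Y i \<noteq> {}"
    and fiber_disjoint: "i \<in> {1..n} \<Longrightarrow> j \<in> {1..n} \<Longrightarrow> i \<noteq> j \<Longrightarrow> Y i \<inter> Y j = {}"
    and rel_partition: "i \<in> {1..n} \<Longrightarrow> j \<in> {1..n} \<Longrightarrow> partition_on (Y i \<times> Y j) (S i j ` {eps i j..s i j})"
    and rel_inj: "i \<in> {1..n} \<Longrightarrow> j \<in> {1..n} \<Longrightarrow> inj_on (S i j) {eps i j..s i j}"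
    and rel_diag: "i \<in> {1..n} \<Longrightarrow> S i i 0 = Id_on (Y i)"
    and rel_converse: "i \<in> {1..n} \<Longrightarrow> j \<in> {1..n} \<Longrightarrow> l \<in> {eps i j..s i j} \<Longrightarrow> (S i j l)\<inverse> = S j i l"
    and num_sym: "i \<in> {1..n} \<Longrightarrow> j \<in> {1..n} \<Longrightarrow> s j i = s i j"
begin

definition relations :: "('a \<times> 'a) set set" where
  "relations = (\<Union>i\<in>{1..n}. \<Union>j\<in>{1..n}. S i j ` {eps i j..s i j})"

lemma fiber_unique: "x \<in> Y i \<Longrightarrow> x \<in> Y j \<Longrightarrow> i \<in> {1..n} \<Longrightarrow> j \<in> {1..n} \<Longrightarrow> i = j"
  using fiber_disjoint by blast

lemma rel_subset:
  "i \<in> {1..n} \<Longrightarrow> j \<in> {1..n} \<Longrightarrow> l \<in> {eps i j..s i j} \<Longrightarrow> S i j l \<subseteq> Y i \<times> Y j"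
  using partition_onD1[OF rel_partition] by blast

lemma rel_nonempty:
  "i \<in> {1..n} \<Longrightarrow> j \<in> {1..n} \<Longrightarrow> l \<in> {eps i j..s i j} \<Longrightarrow> S i j l \<noteq> {}"
  using partition_onD3[OF rel_partition] by blast

lemma rel_unique:
  assumes "i \<in> {1..n}" "j \<in> {1..n}" "l \<in> {eps i j..s i j}" "m \<in> {eps i j..s i j}"
    "p \<in> S i j l" "p \<in> S i j m"
  shows "l = m"
proof (rule ccontr)
  assume "l \<noteq> m"
  then have "S i j l \<noteq> S i j m" using rel_inj[OF assms(1,2)] assms(3,4) by (auto dest: inj_onD)
  then have "S i j l \<inter> S i j m = {}"
    using partition_onD2[OF rel_partition[OF assms(1,2)]] assms(3,4) by (auto simp: disjoint_def)
  then show False using assms by blast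
qed

lemma rel_cover:
  assumes "i \<in> {1..n}" "j \<in> {1..n}" "x \<in> Y i" "y \<in> Y j"
  obtains l where "l \<in> {eps i j..s i j}" "(x, y) \<in> S i j l"
  using partition_onD1[OF rel_partition[OF assms(1,2)]] assms by blast

section \<open>Block spaces and their dimension\<close>

lemma adjacency_in_block: "l \<in> {eps i j..s i j} \<Longrightarrow> adjacency_matrix (S i j l) \<in> block_space s S i j"
  by (auto simp: block_space_def intro: span_base)

lemma block_space_support:
  assumes "M \<in> block_space s S i j" "i \<in> {1..n}" "j \<in> {1..n}" "(x, y) \<notin> Y i \<times> Y j"
  shows "M $ x $ y = 0"
  using assms(1) unfolding block_space_def
proof (induction rule: span_induct)
  show "subspace {M :: real^'a^'a. M $ x $ y = 0}" by (auto simp: subspace_def)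
next
  fix M :: "real^'a^'a" assume "M \<in> (\<lambda>l. adjacency_matrix (S i j l)) ` {eps i j..s i j}"
  then obtain l where l: "l \<in> {eps i j..s i j}" "M = adjacency_matrix (S i j l)" by blast
  then have "(x, y) \<notin> S i j l" using rel_subset[OF assms(2,3)] assms(4) by blast
  then show "M $ x $ y = 0" by (simp add: l adjacency_matrix_def)
qed

lemma block_space_const:
  assumes "M \<in> block_space s S i j" "i \<in> {1..n}" "j \<in> {1..n}"
    and l: "l \<in> {eps i j..s i j}" and xy: "(x, y) \<in> S i j l" "(x', y') \<in> S i j l"
  shows "M $ x $ y = M $ x' $ y'"
  using assms(1) unfolding block_space_def
proof (induction rule: span_induct)
  show "subspace {M :: real^'a^'a. M $ x $ y = M $ x' $ y'}" by (auto simp: subspace_def)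
next
  fix M :: "real^'a^'a" assume "M \<in> (\<lambda>l. adjacency_matrix (S i j l)) ` {eps i j..s i j}"
  then obtain m where m: "m \<in> {eps i j..s i j}" "M = adjacency_matrix (S i j m)" by blast
  then have "(x, y) \<in> S i j m \<longleftrightarrow> (x', y') \<in> S i j m"
    using rel_unique[OF assms(2,3) l m(1)] xy by blast
  then show "M $ x $ y = M $ x' $ y'" by (simp add: m adjacency_matrix_def)
qed

text \<open>Under the entrywise product the adjacency matrices of a block are idempotent and
  annihilate each other; bilinearity does the rest.\<close>

lemma hadamard_in_block_space:
  assumes "i \<in> {1..n}" "j \<in> {1..n}" "A \<in> block_space s S i j" "B \<in> block_space s S i j"
  shows "hadamard A B \<in> block_space s S i j"
proof -
  let ?G = "(\<lambda>l. adjacency_matrix (S i j l) :: real^'a^'a) ` {eps i j..s i j}"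
  have A_span: "A \<in> span ?G" and B_span: "B \<in> span ?G"
    using assms(3,4) by (auto simp: block_space_def)
  have adj: "hadamard (adjacency_matrix (S i j l)) (adjacency_matrix (S i j m)) \<in> block_space s S i j"
    if "l \<in> {eps i j..s i j}" "m \<in> {eps i j..s i j}" for l m
  proof (cases "l = m")
    case True
    then have "hadamard (adjacency_matrix (S i j l)) (adjacency_matrix (S i j m)) = adjacency_matrix (S i j l)"
      by (simp add: hadamard_def adjacency_matrix_def vec_eq_iff)
    then show ?thesis using adjacency_in_block that by simp
  next
    case False
    then have "hadamard (adjacency_matrix (S i j l)) (adjacency_matrix (S i j m)) = 0"
      using rel_unique[OF assms(1,2) that] by (auto simp: hadamard_def adjacency_matrix_def vec_eq_iff)
    then show ?thesis by (simp add: block_space_def span_0)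
  qed
  have sub: "subspace {B. hadamard C B \<in> block_space s S i j}" for C
    unfolding block_space_def
    using linear_subspace_vimage[OF linear_hadamard, OF subspace_span]
    by (simp add: vimage_def)
  have 1: "hadamard A (adjacency_matrix (S i j m)) \<in> block_space s S i j"
    if "m \<in> {eps i j..s i j}" for m
    using A_span
  proof (induction rule: span_induct)
    show "subspace {A. hadamard A (adjacency_matrix (S i j m)) \<in> block_space s S i j}"
      using sub[of "adjacency_matrix (S i j m)"] by (simp add: hadamard_commute)
  qed (use adj that in auto)
  show ?thesis
    using B_span
    by (induction rule: span_induct) (use sub 1 in auto)
qed

lemma dim_block_space: "dim (block_space s S i j) \<le> s i j + 1 - eps i j"
proof -
  have "dim (block_space s S i j) \<le> card ((\<lambda>l. adjacency_matrix (S i j l) :: real^'a^'a) ` {eps i j..s i j})"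
    unfolding block_space_def dim_span by (rule dim_le_card') simp
  also have "\<dots> \<le> s i j + 1 - eps i j" using card_image_le[of "{eps i j..s i j}"] by force
  finally show ?thesis .
qed

end

lemma constant_onI:
  assumes "\<And>x y x' y'. (x, y) \<in> U \<Longrightarrow> (x', y') \<in> U \<Longrightarrow> f x y = f x' y'"
  shows "\<exists>p. \<forall>(x, y)\<in>U. f x y = p"
proof (cases "U = {}")
  case False
  then obtain a b where "(a, b) \<in> U" by auto
  then show ?thesis using assms by (intro exI[of _ "f a b"]) blast
qed simp

context labelled_partition
begin

section \<open>The labelled relations as a partition with fibers \<open>Y i\<close>\<close>

lemma relationsI: "i \<in> {1..n} \<Longrightarrow> j \<in> {1..n} \<Longrightarrow> l \<in> {eps i j..s i j} \<Longrightarrow> S i j l \<in> relations"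
  unfolding relations_def by blast

lemma relationsE:
  assumes "T \<in> relations"
  obtains i j l where "i \<in> {1..n}" "j \<in> {1..n}" "l \<in> {eps i j..s i j}" "T = S i j l"
  using assms unfolding relations_def by blast

lemma rel_block_unique:
  assumes "i \<in> {1..n}" "j \<in> {1..n}" "l \<in> {eps i j..s i j}"
    and "i' \<in> {1..n}" "j' \<in> {1..n}" "S i j l \<subseteq> Y i' \<times> Y j'"
  shows "i' = i" "j' = j"
proof -
  obtain x y where "(x, y) \<in> S i j l" using rel_nonempty[OF assms(1-3)] by auto
  then have "x \<in> Y i" "y \<in> Y j" "x \<in> Y i'" "y \<in> Y j'" using rel_subset[OF assms(1-3)] assms(6) by auto
  then show "i' = i" "j' = j" using fiber_unique assms by blast+
qed

lemma relations_unique: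
  assumes "i \<in> {1..n}" "j \<in> {1..n}" "l \<in> {eps i j..s i j}"
    and "i' \<in> {1..n}" "j' \<in> {1..n}" "l' \<in> {eps i' j'..s i' j'}"
    and "p \<in> S i j l" "p \<in> S i' j' l'"
  shows "i = i' \<and> j = j' \<and> l = l'"
proof -
  obtain x y where p: "p = (x, y)" by force
  have "x \<in> Y i" "y \<in> Y j" "x \<in> Y i'" "y \<in> Y j'"
    using rel_subset[OF assms(1-3)] rel_subset[OF assms(4-6)] assms(7,8) p by auto
  then have "i = i'" "j = j'" using fiber_unique assms by blast+
  then show ?thesis using rel_unique assms by blast
qed

lemma relations_partition: "partition_on ((\<Union>i\<in>{1..n}. Y i) \<times> (\<Union>i\<in>{1..n}. Y i)) relations"
proof (rule partition_onI)
  show "\<Union> relations = (\<Union>i\<in>{1..n}. Y i) \<times> (\<Union>i\<in>{1..n}. Y i)"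
  proof
    show "\<Union> relations \<subseteq> (\<Union>i\<in>{1..n}. Y i) \<times> (\<Union>i\<in>{1..n}. Y i)"
    proof
      fix p assume "p \<in> \<Union> relations"
      then obtain i j l where "i \<in> {1..n}" "j \<in> {1..n}" "l \<in> {eps i j..s i j}" "p \<in> S i j l"
        by (auto elim: relationsE)
      then have "p \<in> Y i \<times> Y j" "i \<in> {1..n}" "j \<in> {1..n}" using rel_subset by blast+
      then show "p \<in> (\<Union>i\<in>{1..n}. Y i) \<times> (\<Union>i\<in>{1..n}. Y i)" by blast
    qed
    show "(\<Union>i\<in>{1..n}. Y i) \<times> (\<Union>i\<in>{1..n}. Y i) \<subseteq> \<Union> relations"
    proof
      fix p assume "p \<in> (\<Union>i\<in>{1..n}. Y i) \<times> (\<Union>i\<in>{1..n}. Y i)"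
      then obtain i j x y where "i \<in> {1..n}" "j \<in> {1..n}" "p = (x, y)" "x \<in> Y i" "y \<in> Y j" by blast
      then show "p \<in> \<Union> relations" by (metis UnionI relationsI rel_cover)
    qed
  qed
next
  fix T T' assume "T \<in> relations" "T' \<in> relations" "T \<noteq> T'"
  then show "disjnt T T'"
    unfolding disjnt_iff by (elim relationsE) (use relations_unique in blast)
next
  show "{} \<notin> relations" using rel_nonempty by (metis relationsE)
qed

lemma rel_meets_diagonal:
  assumes ij: "i \<in> {1..n}" "j \<in> {1..n}" and l: "l \<in> {eps i j..s i j}" and "(x, x) \<in> S i j l"
  shows "i = j" "l = 0"
proof -
  have "x \<in> Y i" "x \<in> Y j" using rel_subset[OF ij l] assms(4) by auto
  then show "i = j" using fiber_unique ij by blast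
  have "(x, x) \<in> S i i 0" using rel_diag[OF ij(1)] \<open>x \<in> Y i\<close> by auto
  then show "l = 0" using rel_unique[OF ij l, of 0] assms(4) \<open>i = j\<close> by (auto simp: eps_def)
qed

lemma fibers_relations: "fibers relations = Y ` {1..n}"
proof
  show "fibers relations \<subseteq> Y ` {1..n}"
  proof
    fix A assume "A \<in> fibers relations"
    then obtain i j l where l: "i \<in> {1..n}" "j \<in> {1..n}" "l \<in> {eps i j..s i j}" "Id_on A = S i j l"
      by (auto simp: fibers_def elim: relationsE)
    then obtain x where "(x, x) \<in> S i j l" using rel_nonempty[OF l(1-3)] by (metis Id_onE ex_in_conv)
    then have "i = j" "l = 0" using rel_meets_diagonal l by blast+
    then have "Id_on A = Id_on (Y i)" using rel_diag[OF l(1)] l(4) by simp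
    then have "A = Y i" by (metis Domain_Id_on)
    then show "A \<in> Y ` {1..n}" using l(1) by blast
  qed
  show "Y ` {1..n} \<subseteq> fibers relations"
  proof
    fix A assume "A \<in> Y ` {1..n}"
    then obtain i where i: "i \<in> {1..n}" "A = Y i" by blast
    then show "A \<in> fibers relations"
      using relationsI[OF i(1) i(1), of 0] rel_diag[OF i(1)] by (simp add: fibers_def eps_def)
  qed
qed

lemma cc_labelling_relations: "cc_labelling relations n Y s S"
  unfolding cc_labelling_def
proof (intro conjI ballI)
  show "bij_betw Y {1..n} (fibers relations)"
    unfolding bij_betw_def fibers_relations using fiber_disjoint fiber_nonempty
    by (metis inf.idem inj_onI)
next
  fix i assume "i \<in> {1..n}"
  then show "S i i 0 = Id_on (Y i)" by (rule rel_diag)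
next
  fix i j assume ij: "i \<in> {1..n}" "j \<in> {1..n}"
  have "S i j ` {eps i j..s i j} = {T \<in> relations. T \<subseteq> Y i \<times> Y j}"
  proof
    show "S i j ` {eps i j..s i j} \<subseteq> {T \<in> relations. T \<subseteq> Y i \<times> Y j}"
      using rel_subset[OF ij] relationsI[OF ij] by blast
    show "{T \<in> relations. T \<subseteq> Y i \<times> Y j} \<subseteq> S i j ` {eps i j..s i j}"
    proof
      fix T assume T: "T \<in> {T \<in> relations. T \<subseteq> Y i \<times> Y j}"
      then obtain i' j' l where l: "i' \<in> {1..n}" "j' \<in> {1..n}" "l \<in> {eps i' j'..s i' j'}" "T = S i' j' l"
        by (auto elim: relationsE)
      then have "i = i'" "j = j'" using rel_block_unique[OF l(1-3) ij] T by auto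
      then show "T \<in> S i j ` {eps i j..s i j}" using l by blast
    qed
  qed
  then show "bij_betw (S i j) {eps i j..s i j} {T \<in> relations. T \<subseteq> Y i \<times> Y j}"
    using rel_inj[OF ij] by (simp add: bij_betw_def)
  show "s j i = s i j" using ij by (rule num_sym)
  fix l assume "l \<in> {eps i j..s i j}"
  then show "(S i j l)\<inverse> = S j i l" using rel_converse ij by blast
qed

text \<open>A nonempty block contains a relation. This keeps the natural subtraction in
  \<open>r_tilde\<close> from truncating.\<close>

lemma eps_le_num: "i \<in> {1..n} \<Longrightarrow> j \<in> {1..n} \<Longrightarrow> eps i j \<le> s i j"
  using rel_cover fiber_nonempty by (metis atLeastAtMost_iff ex_in_conv order_trans)

end

text \<open>The basis conditions \<open>QB1\<close> to \<open>QB4\<close> without the Krein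
  condition. Coherence, the schemes on the fibers and the basis of the whole algebra follow from
  them, so the locale serves both the given and the restricted configuration.\<close>

locale Q_basis = labelled_partition n Y s S
  for n :: nat and Y :: "nat \<Rightarrow> 'a::finite set" and s :: "nat \<Rightarrow> nat \<Rightarrow> nat"
    and S :: "nat \<Rightarrow> nat \<Rightarrow> nat \<Rightarrow> ('a \<times> 'a) set" +
  fixes E :: "nat \<Rightarrow> nat \<Rightarrow> nat \<Rightarrow> real^'a^'a"
  assumes qb1: "QB1 n Y E" and qb2: "QB2 n s S E" and qb3: "QB3 n s E" and qb4: "QB4 n s E"
begin

section \<open>Products and inner products of the basis matrices\<close>

lemma E_span: "i \<in> {1..n} \<Longrightarrow> j \<in> {1..n} \<Longrightarrow> span (E i j ` {0..r_tilde s i j}) = block_space s S i j"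
  and E_inj: "i \<in> {1..n} \<Longrightarrow> j \<in> {1..n} \<Longrightarrow> inj_on (E i j) {0..r_tilde s i j}"
  and E_independent: "i \<in> {1..n} \<Longrightarrow> j \<in> {1..n} \<Longrightarrow> independent (E i j ` {0..r_tilde s i j})"
  using qb2 unfolding QB2_def indexed_basis_def by blast+

lemma E_in_block: "i \<in> {1..n} \<Longrightarrow> j \<in> {1..n} \<Longrightarrow> l \<le> r_tilde s i j \<Longrightarrow> E i j l \<in> block_space s S i j"
  using E_span by (metis atLeastAtMost_iff image_eqI span_base zero_le)

lemma E_nonzero: "i \<in> {1..n} \<Longrightarrow> j \<in> {1..n} \<Longrightarrow> l \<le> r_tilde s i j \<Longrightarrow> E i j l \<noteq> 0"
  using E_independent dependent_zero by (metis atLeastAtMost_iff image_eqI zero_le)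

lemma E_expand:
  assumes "i \<in> {1..n}" "j \<in> {1..n}" "M \<in> block_space s S i j"
  obtains c where "M = (\<Sum>k\<le>r_tilde s i j. c k *\<^sub>R E i j k)"
  using in_span_image_finiteD[of "{0..r_tilde s i j}" "E i j" M] E_inj E_span assms
  by (metis atLeast0AtMost finite_atLeastAtMost)

lemma E_transpose: "i \<in> {1..n} \<Longrightarrow> j \<in> {1..n} \<Longrightarrow> l \<le> r_tilde s i j \<Longrightarrow> transpose (E i j l) = E j i l"
  using qb3 unfolding QB3_def by simp

lemma E_0: "i \<in> {1..n} \<Longrightarrow> j \<in> {1..n} \<Longrightarrow>
    E i j 0 = (1 / sqrt (real (card (Y i)) * real (card (Y j)))) *\<^sub>R adjacency_matrix (Y i \<times> Y j)"
  using qb1 unfolding QB1_def by blast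

lemma E_0_nth:
  "i \<in> {1..n} \<Longrightarrow> j \<in> {1..n} \<Longrightarrow> x \<in> Y i \<Longrightarrow> y \<in> Y j \<Longrightarrow>
    E i j 0 $ x $ y = 1 / sqrt (real (card (Y i)) * real (card (Y j)))"
  by (simp add: E_0 adjacency_matrix_def)

lemma hadamard_E_0:
  assumes ij: "i \<in> {1..n}" "j \<in> {1..n}" and M: "M \<in> block_space s S i j"
  shows "hadamard (E i j 0) M = (1 / sqrt (real (card (Y i)) * real (card (Y j)))) *\<^sub>R M"
proof -
  have "E i j 0 $ x $ y * M $ x $ y = 1 / sqrt (real (card (Y i)) * real (card (Y j))) * M $ x $ y" for x y
  proof (cases "(x, y) \<in> Y i \<times> Y j")
    case True
    then show ?thesis using E_0_nth[OF ij, of x y] by simp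
  next
    case False
    then have "M $ x $ y = 0" by (rule block_space_support[OF M ij])
    then show ?thesis by simp
  qed
  then show ?thesis
    unfolding vec_eq_iff hadamard_def vec_lambda_beta vector_scaleR_component real_scaleR_def by blast
qed

lemma r_tilde_sym: "i \<in> {1..n} \<Longrightarrow> j \<in> {1..n} \<Longrightarrow> r_tilde s j i = r_tilde s i j"
  by (simp add: r_tilde_def num_sym[of i j] eps_def)

lemma E_mult:
  assumes "i \<in> {1..n}" "j \<in> {1..n}" "h \<in> {1..n}" "l \<le> r_tilde s i j" "m \<le> r_tilde s j h"
  shows "E i j l ** E j h m = (if l = m then E i h l else 0)"
proof (cases "l = m")
  case True then show ?thesis using qb4 assms unfolding QB4_def by (metis atLeastAtMost_iff zero_le)
next
  case False then show ?thesis using qb4 assms unfolding QB4_def by (metis atLeastAtMost_iff zero_le)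
qed

lemma E_mult_0:
  assumes "i \<in> {1..n}" "j \<in> {1..n}" "i' \<in> {1..n}" "h \<in> {1..n}" "l \<le> r_tilde s i j" "m \<le> r_tilde s i' h"
    "l \<noteq> m \<or> j \<noteq> i'"
  shows "E i j l ** E i' h m = 0"
  using qb4 assms unfolding QB4_def by (metis atLeastAtMost_iff zero_le)

lemma r_tilde_trans:
  "i \<in> {1..n} \<Longrightarrow> j \<in> {1..n} \<Longrightarrow> h \<in> {1..n} \<Longrightarrow> l \<le> r_tilde s i j \<Longrightarrow> l \<le> r_tilde s j h \<Longrightarrow> l \<le> r_tilde s i h"
  using qb4 unfolding QB4_def by (metis atLeastAtMost_iff zero_le)

text \<open>The product of \<open>E i j l\<close> and \<open>E j i l\<close> is
  \<open>E i i l\<close>, and \<open>QB4\<close> includes the claim that its index exists.\<close>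

lemma r_tilde_le_fiber:
  assumes "i \<in> {1..n}" "j \<in> {1..n}"
  shows "r_tilde s i j \<le> r_tilde s i i" "r_tilde s i j \<le> r_tilde s j j"
  using r_tilde_trans[OF assms(1,2,1)] r_tilde_trans[OF assms(2,1,2)] r_tilde_sym[OF assms] by auto

lemma E_orthogonal:
  assumes "i \<in> {1..n}" "j \<in> {1..n}" "l \<le> r_tilde s i j" "m \<le> r_tilde s i j" "l \<noteq> m"
  shows "E i j l \<bullet> E i j m = 0"
  using inner_matrix_eq_0I[of "E i j l" "E i j m"] E_transpose[OF assms(1,2,4)]
    E_mult[OF assms(1,2,1,3), of m] r_tilde_sym[OF assms(1,2)] assms by simp

lemma block_space_mult:
  assumes "i \<in> {1..n}" "j \<in> {1..n}" "h \<in> {1..n}" "A \<in> block_space s S i j" "B \<in> block_space s S j h"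
  shows "A ** B \<in> block_space s S i h"
proof -
  have "A ** B \<in> span (E i h ` {0..r_tilde s i h})"
  proof (rule span_mul_closed)
    show "A \<in> span (E i j ` {0..r_tilde s i j})" "B \<in> span (E j h ` {0..r_tilde s j h})"
      using E_span assms by auto
  next
    fix M N assume "M \<in> E i j ` {0..r_tilde s i j}" "N \<in> E j h ` {0..r_tilde s j h}"
    then obtain l m where lm: "l \<le> r_tilde s i j" "m \<le> r_tilde s j h" "M = E i j l" "N = E j h m" by auto
    then show "M ** N \<in> span (E i h ` {0..r_tilde s i h})"
      using E_mult[OF assms(1-3) lm(1,2)] r_tilde_trans[OF assms(1-3), of l]
      by (auto intro: span_base span_0)
  qed
  then show ?thesis using E_span assms by auto
qed

text \<open>The count is an entry of a product of two adjacency matrices; this product lies in a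
  block space and so is constant on each relation. The set \<open>A\<close> is kept general because
  the count runs over all points for coherence and over one fiber for its scheme.\<close>

lemma intersection_number:
  assumes ij: "i \<in> {1..n}" "j \<in> {1..n}" "a \<in> {eps i j..s i j}"
    and jh: "j' \<in> {1..n}" "h \<in> {1..n}" "b \<in> {eps j' h..s j' h}"
    and U: "i' \<in> {1..n}" "h' \<in> {1..n}" "c \<in> {eps i' h'..s i' h'}"
    and A: "Y j \<subseteq> A" "finite A"
  shows "\<exists>p. \<forall>(x, y)\<in>S i' h' c. card {z \<in> A. (x, z) \<in> S i j a \<and> (z, y) \<in> S j' h b} = p"
proof -
  let ?N = "\<lambda>x y. {z \<in> A. (x, z) \<in> S i j a \<and> (z, y) \<in> S j' h b}"
  let ?M = "adjacency_matrix (S i j a) ** adjacency_matrix (S j' h b) :: real^'a^'a"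
  have eq: "?N x y = {z. (x, z) \<in> S i j a \<and> (z, y) \<in> S j' h b}" for x y
    using rel_subset[OF ij] A(1) by blast
  have card: "real (card (?N x y)) = ?M $ x $ y" for x y
  proof -
    have "?M $ x $ y = (\<Sum>z\<in>UNIV. if (x, z) \<in> S i j a \<and> (z, y) \<in> S j' h b then 1 else 0)"
      unfolding matrix_mul_nth adjacency_matrix_def by (intro sum.cong) auto
    then show ?thesis unfolding eq by (simp add: sum.If_cases)
  qed
  show ?thesis
  proof (cases "j = j' \<and> i' = i \<and> h' = h")
    case True
    then have M: "?M \<in> block_space s S i h"
      using block_space_mult[OF ij(1,2) jh(2) adjacency_in_block[OF ij(3)] adjacency_in_block[of b]] jh(3) by simp
    have const: "?M $ x $ y = ?M $ x' $ y'" if "(x, y) \<in> S i' h' c" "(x', y') \<in> S i' h' c" for x y x' y'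
      using block_space_const[OF M ij(1) jh(2)] that True U by blast
    have "card (?N x y) = card (?N x' y')" if "(x, y) \<in> S i' h' c" "(x', y') \<in> S i' h' c" for x y x' y'
      using const[OF that] card[of x y] card[of x' y'] by linarith
    then show ?thesis by (rule constant_onI[where f = "\<lambda>x y. card (?N x y)"])
  next
    case False
    \<comment> \<open>If the blocks do not fit together, disjointness of the fibers makes all counts
      0.\<close>
    have empty: "?N x y = {}" if xy: "(x, y) \<in> S i' h' c" for x y
    proof (rule ccontr)
      assume "?N x y \<noteq> {}"
      then obtain z where "(x, z) \<in> S i j a" "(z, y) \<in> S j' h b" by blast
      then have x: "x \<in> Y i" "x \<in> Y i'" and y: "y \<in> Y h" "y \<in> Y h'" and z: "z \<in> Y j" "z \<in> Y j'"
        using subsetD[OF rel_subset[OF ij], of "(x, z)"] subsetD[OF rel_subset[OF jh], of "(z, y)"]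
          subsetD[OF rel_subset[OF U] xy] by simp_all
      show False
        using False fiber_unique[OF x ij(1) U(1)] fiber_unique[OF y jh(2) U(2)] fiber_unique[OF z ij(2) jh(1)]
        by simp
    qed
    show ?thesis by (rule constant_onI[where f = "\<lambda>x y. card (?N x y)"]) (simp only: empty)
  qed
qed

lemma coherent_configuration_relations: "coherent_configuration (\<Union>i\<in>{1..n}. Y i) relations"
  unfolding coherent_configuration_def
proof (intro conjI ballI impI)
  show "finite (\<Union>i\<in>{1..n}. Y i)" by simp
  show "(\<Union>i\<in>{1..n}. Y i) \<noteq> {}" using fiber_nonempty[of 1] n_pos by force
  show "partition_on ((\<Union>i\<in>{1..n}. Y i) \<times> (\<Union>i\<in>{1..n}. Y i)) relations" by (rule relations_partition)
next
  fix T assume "T \<in> relations"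
  then obtain i j l where l: "i \<in> {1..n}" "j \<in> {1..n}" "l \<in> {eps i j..s i j}" "T = S i j l"
    by (rule relationsE)
  then have "l \<in> {eps j i..s j i}" using num_sym[OF l(1,2)] by (auto simp: eps_def)
  then show "T\<inverse> \<in> relations" using rel_converse[OF l(1-3)] relationsI[OF l(2,1)] l by simp
  assume "T \<inter> Id_on (\<Union>i\<in>{1..n}. Y i) \<noteq> {}"
  then obtain x where "(x, x) \<in> S i j l" using l by auto
  then have "i = j" "l = 0" using rel_meets_diagonal l by blast+
  then have "T = Id_on (Y i)" using rel_diag[OF l(1)] l(4) by simp
  then show "T \<subseteq> Id_on (\<Union>i\<in>{1..n}. Y i)" using l(1) by auto
next
  fix T T' U assume "T \<in> relations" "T' \<in> relations" "U \<in> relations"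
  then obtain i j a i1 j1 b i2 j2 c where
    T: "i \<in> {1..n}" "j \<in> {1..n}" "a \<in> {eps i j..s i j}" "T = S i j a" and
    T': "i1 \<in> {1..n}" "j1 \<in> {1..n}" "b \<in> {eps i1 j1..s i1 j1}" "T' = S i1 j1 b" and
    U: "i2 \<in> {1..n}" "j2 \<in> {1..n}" "c \<in> {eps i2 j2..s i2 j2}" "U = S i2 j2 c"
    by (metis relationsE)
  have "Y j \<subseteq> (\<Union>i\<in>{1..n}. Y i)" using T(2) by blast
  then show "\<exists>p. \<forall>(x, y)\<in>U. card {z \<in> \<Union>i\<in>{1..n}. Y i. (x, z) \<in> T \<and> (z, y) \<in> T'} = p"
    unfolding T(4) T'(4) U(4)
    by (rule intersection_number[OF T(1-3) T'(1-3) U(1-3)]) simp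
qed

lemma fiber_scheme:
  assumes i: "i \<in> {1..n}"
  shows "symmetric_association_scheme (Y i) (s i i) (S i i)"
proof -
  have e: "eps i i = 0" by (simp add: eps_def)
  have "\<exists>p. \<forall>(x, y)\<in>S i i m. card {z \<in> Y i. (x, z) \<in> S i i k \<and> (z, y) \<in> S i i l} = p"
    if "k \<in> {0..s i i}" "l \<in> {0..s i i}" "m \<in> {0..s i i}" for k l m
    using that unfolding e[symmetric] by (intro intersection_number i) simp_all
  moreover have "(S i i l)\<inverse> = S i i l" if "l \<in> {0..s i i}" for l
    using rel_converse[OF i i] that e by simp
  ultimately show ?thesis
    unfolding symmetric_association_scheme_def
    using fiber_nonempty[OF i] rel_inj[OF i i] rel_partition[OF i i] rel_diag[OF i] e by simp
qed

lemma total_basis: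
  "indexed_basis (\<lambda>(i, j, l). E i j l)
     {(i, j, l). i \<in> {1..n} \<and> j \<in> {1..n} \<and> l \<in> {0..r_tilde s i j}} (coherent_algebra relations)"
  (is "indexed_basis ?f ?I _")
proof -
  have "\<exists>\<phi> :: real^'a^'a \<Rightarrow> real^'a^'a. linear \<phi> \<and> \<phi> (?f t) \<noteq> 0 \<and> (\<forall>u\<in>?I - {t}. \<phi> (?f u) = 0)"
    if t_in: "t \<in> ?I" for t
  proof -
    obtain i j l where t: "t = (i, j, l)" and ij: "i \<in> {1..n}" "j \<in> {1..n}" and l: "l \<le> r_tilde s i j"
      using t_in by auto
    have l': "l \<le> r_tilde s i i" "l \<le> r_tilde s j j" using r_tilde_le_fiber[OF ij] l by auto
    \<comment> \<open>Multiplication by \<open>E i i l\<close> on the left and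
      \<open>E j j l\<close> on the right fixes \<open>E i j l\<close>; any other basis matrix has a
      wrong index or a wrong block on one side and is killed there.\<close>
    let ?\<phi> = "\<lambda>M. E i i l ** M ** E j j l"
    have "linear ?\<phi>"
      using linear_compose[OF linear_matrix_mul_left[of "E i i l"] linear_matrix_mul_right[of "E j j l"]]
      by (simp add: o_def)
    moreover have "?\<phi> (?f t) \<noteq> 0"
      using E_mult[OF ij(1,1,2) l'(1) l] E_mult[OF ij(1,2,2) l l'(2)] E_nonzero[OF ij l] t by simp
    moreover have "?\<phi> (?f u) = 0" if u: "u \<in> ?I - {t}" for u
    proof -
      obtain i' j' m where u': "u = (i', j', m)" and ij': "i' \<in> {1..n}" "j' \<in> {1..n}" "m \<le> r_tilde s i' j'"
        using u by auto
      show ?thesis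
      proof (cases "l = m \<and> i = i'")
        case True
        then have "j' \<noteq> j" using u u' t by auto
        then have "E i j' m ** E j j l = 0"
          using E_mult_0[OF ij(1) ij'(2) ij(2,2) _ l'(2)] ij'(3) True by blast
        then show ?thesis using u' True E_mult[OF ij(1,1) ij'(2) l'(1)] ij'(3) by simp
      next
        case False
        then have "E i i l ** E i' j' m = 0" using E_mult_0[OF ij(1,1) ij'(1,2) l'(1) ij'(3)] by blast
        then show ?thesis using u' by simp
      qed
    qed
    ultimately show ?thesis by blast
  qed
  from independent_familyI[of ?I, OF this] have "inj_on ?f ?I" "independent (?f ` ?I)" by auto
  moreover have "span (?f ` ?I) = coherent_algebra relations"
    unfolding coherent_algebra_def
  proof (rule subset_antisym; rule span_minimal[OF _ subspace_span]; rule subsetI)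
    fix M assume "M \<in> ?f ` ?I"
    then obtain i j l where ij: "i \<in> {1..n}" "j \<in> {1..n}" "l \<le> r_tilde s i j" "M = E i j l" by auto
    have "block_space s S i j \<subseteq> span (adjacency_matrix ` relations)"
      unfolding block_space_def using relationsI[OF ij(1,2)] by (intro span_mono) blast
    then show "M \<in> span (adjacency_matrix ` relations)" using E_in_block[OF ij(1-3)] ij(4) by blast
  next
    fix M :: "real^'a^'a" assume "M \<in> adjacency_matrix ` relations"
    then obtain i j l where ij: "i \<in> {1..n}" "j \<in> {1..n}" "l \<in> {eps i j..s i j}" "M = adjacency_matrix (S i j l)"
      by (auto elim: relationsE)
    then have "M \<in> span (E i j ` {0..r_tilde s i j})" using adjacency_in_block E_span[OF ij(1,2)] by simp
    moreover have "E i j ` {0..r_tilde s i j} \<subseteq> ?f ` ?I" using ij(1,2) by force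
    ultimately show "M \<in> span (?f ` ?I)" using span_mono by blast
  qed
  ultimately show ?thesis unfolding indexed_basis_def by blast
qed

text \<open>
  Since \<open>hadamard A B \<bullet> C\<close> is symmetric in \<open>A\<close>, \<open>B\<close>, \<open>C\<close>, the entries of the Krein matrix below the
  diagonal and its last row are determined by the entries on and above the diagonal of the other rows.
\<close>

lemma krein_tridiagonal:
  assumes row: "\<And>i j m k. i \<in> {1..n} \<Longrightarrow> j \<in> {1..n} \<Longrightarrow> m < k \<Longrightarrow> k \<le> r_tilde s i j \<Longrightarrow>
      hadamard (E i j 1) (E i j m) \<bullet> E i j k = 0 \<longleftrightarrow> k \<noteq> m + 1"
  shows "\<exists>q. krein_parameters n Y s E q \<and>
    (\<forall>i\<in>{1..n}. \<forall>j\<in>{1..n}. irreducible_tridiagonal (q i j 1) (r_tilde s i j))"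
proof -
  define \<nu> where "\<nu> i j = 1 / sqrt (real (card (Y i)) * real (card (Y j)))" for i j
  have \<nu>: "\<nu> i j \<noteq> 0" if "i \<in> {1..n}" "j \<in> {1..n}" for i j
    using fiber_nonempty that by (simp add: \<nu>_def card_eq_0_iff)
  \<comment> \<open>As the \<open>E i j k\<close> of a block are orthogonal, this is the expansion
    coefficient of the entrywise product, freed from the normalizing factor.\<close>
  define q where "q i j l m k = (hadamard (E i j l) (E i j m) \<bullet> E i j k) / (\<nu> i j * (E i j k \<bullet> E i j k))"
    for i j l m k
  have "hadamard (E i j l) (E i j m) = \<nu> i j *\<^sub>R (\<Sum>k = 0..r_tilde s i j. q i j l m k *\<^sub>R E i j k)"
    if ij: "i \<in> {1..n}" "j \<in> {1..n}" and lm: "l \<le> r_tilde s i j" "m \<le> r_tilde s i j" for i j l m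
  proof -
    have "hadamard (E i j l) (E i j m) \<in> block_space s S i j"
      using hadamard_in_block_space[OF ij] E_in_block[OF ij] lm by blast
    then obtain c where c: "hadamard (E i j l) (E i j m) = (\<Sum>k\<le>r_tilde s i j. c k *\<^sub>R E i j k)"
      using E_expand[OF ij] by blast
    have "c k = \<nu> i j * q i j l m k" if k: "k \<le> r_tilde s i j" for k
    proof -
      have "hadamard (E i j l) (E i j m) \<bullet> E i j k = (\<Sum>k'\<le>r_tilde s i j. c k' * (E i j k' \<bullet> E i j k))"
        by (simp add: c inner_sum_left)
      also have "\<dots> = (\<Sum>k'\<le>r_tilde s i j. if k' = k then c k * (E i j k \<bullet> E i j k) else 0)"
        using E_orthogonal[OF ij _ k] by (intro sum.cong) auto
      finally have "hadamard (E i j l) (E i j m) \<bullet> E i j k = c k * (E i j k \<bullet> E i j k)" using k by simp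
      then show ?thesis using E_nonzero[OF ij k] \<nu>[OF ij] by (simp add: q_def)
    qed
    then show ?thesis unfolding c scaleR_sum_right atLeast0AtMost by (intro sum.cong) auto
  qed
  then have "krein_parameters n Y s E q" unfolding krein_parameters_def \<nu>_def by auto
  moreover have "irreducible_tridiagonal (q i j 1) (r_tilde s i j)" if ij: "i \<in> {1..n}" "j \<in> {1..n}" for i j
  proof -
    have q0: "q i j 1 m k = 0 \<longleftrightarrow> hadamard (E i j 1) (E i j m) \<bullet> E i j k = 0" if "k \<le> r_tilde s i j" for m k
      using E_nonzero[OF ij that] \<nu>[OF ij] by (simp add: q_def)
    have "q i j 1 m k = 0 \<longleftrightarrow> k \<noteq> m + 1 \<and> m \<noteq> k + 1"
      if "m \<le> r_tilde s i j" "k \<le> r_tilde s i j" "m \<noteq> k" for m k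
      using row[OF ij, of m k] row[OF ij, of k m] q0[OF that(2)] hadamard_inner_swap[of "E i j 1" "E i j m" "E i j k"] that
      by (cases "m < k") auto
    then show ?thesis unfolding irreducible_tridiagonal_def by auto
  qed
  ultimately show ?thesis by blast
qed

theorem Q_polynomial_dataI:
  assumes "\<And>i j m k. i \<in> {1..n} \<Longrightarrow> j \<in> {1..n} \<Longrightarrow> m < k \<Longrightarrow> k \<le> r_tilde s i j \<Longrightarrow>
      hadamard (E i j 1) (E i j m) \<bullet> E i j k = 0 \<longleftrightarrow> k \<noteq> m + 1"
  shows "Q_polynomial_data (\<Union>i\<in>{1..n}. Y i) relations n Y s S E"
  unfolding Q_polynomial_data_def
  using coherent_configuration_relations cc_labelling_relations fiber_scheme total_basis
    qb1 qb2 qb3 qb4 krein_tridiagonal[OF assms] by simp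

end

section \<open>Polynomiality and design products\<close>

locale Q_configuration =
  fixes X :: "'a::finite set" and \<R> :: "('a \<times> 'a) set set"
    and n :: nat and F :: "nat \<Rightarrow> 'a set" and r :: "nat \<Rightarrow> nat \<Rightarrow> nat"
    and R :: "nat \<Rightarrow> nat \<Rightarrow> nat \<Rightarrow> ('a \<times> 'a) set"
    and E :: "nat \<Rightarrow> nat \<Rightarrow> nat \<Rightarrow> real^'a^'a"
  assumes Q_data: "Q_polynomial_data X \<R> n F r R E"
begin

section \<open>Fibers and labels of the given configuration\<close>

lemma R_partition: "partition_on (X \<times> X) \<R>" and X_nonempty: "X \<noteq> {}"
  using Q_data unfolding Q_polynomial_data_def coherent_configuration_def by auto

lemma R_disjoint: "S \<in> \<R> \<Longrightarrow> T \<in> \<R> \<Longrightarrow> p \<in> S \<Longrightarrow> p \<in> T \<Longrightarrow> S = T"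
  using partition_onD2[OF R_partition] by (auto simp: disjoint_def)

lemma labelling: "cc_labelling \<R> n F r R"
  using Q_data unfolding Q_polynomial_data_def by blast

lemma F_bij: "bij_betw F {1..n} (fibers \<R>)"
  using labelling unfolding cc_labelling_def by simp

lemma F_inj: "inj_on F {1..n}"
  using F_bij by (rule bij_betw_imp_inj_on)

lemma Id_fiber: "i \<in> {1..n} \<Longrightarrow> Id_on (F i) \<in> \<R>"
  using bij_betwE[OF F_bij] by (simp add: fibers_def)

lemma R_image:
  "i \<in> {1..n} \<Longrightarrow> j \<in> {1..n} \<Longrightarrow> R i j ` {eps i j..r i j} = {S \<in> \<R>. S \<subseteq> F i \<times> F j}"
  using labelling unfolding cc_labelling_def bij_betw_def by simp

lemma F_nonempty: "i \<in> {1..n} \<Longrightarrow> F i \<noteq> {}"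
  using Id_fiber partition_onD3[OF R_partition] by fastforce

text \<open>The relation through a diagonal point is contained in the diagonal, so it is
  \<open>Id_on\<close> of its domain, and that domain is a fiber.\<close>

lemma fiber_index_nonempty: "n \<ge> 1"
proof -
  obtain x where x: "x \<in> X" using X_nonempty by blast
  then obtain S where S: "S \<in> \<R>" "(x, x) \<in> S" using partition_onD1[OF R_partition] by blast
  then have "S \<inter> Id_on X \<noteq> {}" using x by blast
  then have sub: "S \<subseteq> Id_on X"
    using S Q_data unfolding Q_polynomial_data_def coherent_configuration_def by blast
  have "S = Id_on (Domain S)"
  proof
    show "S \<subseteq> Id_on (Domain S)" using sub by blast
    show "Id_on (Domain S) \<subseteq> S" using sub by blast
  qed
  then have "Domain S \<in> fibers \<R>" using S unfolding fibers_def by simp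
  then have "{1..n} \<noteq> {}" using F_bij by (metis bij_betw_empty1 empty_iff)
  then show ?thesis by simp
qed

text \<open>
  That the relations labelled by \<open>(i, j)\<close> cover \<open>F i \<times> F j\<close> is read off from \<open>QB1\<close> and \<open>QB2\<close>: the
  all-ones matrix of the block lies in their span.
\<close>

lemma R_cover:
  assumes ij: "i \<in> {1..n}" "j \<in> {1..n}" and xy: "x \<in> F i" "y \<in> F j"
  shows "\<exists>l\<in>{eps i j..r i j}. (x, y) \<in> R i j l"
proof (rule ccontr)
  assume none: "\<not> (\<exists>l\<in>{eps i j..r i j}. (x, y) \<in> R i j l)"
  have zero: "M $ x $ y = 0" if "M \<in> block_space r R i j" for M
    using that unfolding block_space_def
  proof (induction rule: span_induct)
    show "subspace {M :: real^'a^'a. M $ x $ y = 0}" by (auto simp: subspace_def)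
  qed (use none in \<open>auto simp: adjacency_matrix_def\<close>)
  have "QB1 n F E" "QB2 n r R E" using Q_data unfolding Q_polynomial_data_def by blast+
  then have E0: "E i j 0 = (1 / sqrt (real (card (F i)) * real (card (F j)))) *\<^sub>R adjacency_matrix (F i \<times> F j)"
    and "span (E i j ` {0..r_tilde r i j}) = block_space r R i j"
    using ij unfolding QB1_def QB2_def indexed_basis_def by blast+
  then have "E i j 0 \<in> block_space r R i j" by (metis atLeastAtMost_iff image_eqI order.refl span_base zero_le)
  then have "E i j 0 $ x $ y = 0" by (rule zero)
  then show False using xy F_nonempty[OF ij(1)] F_nonempty[OF ij(2)]
    by (simp add: E0 adjacency_matrix_def card_eq_0_iff)
qed

sublocale Q_basis n F r R E
proof
  show "n \<ge> 1" by (rule fiber_index_nonempty)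
  show "QB1 n F E" "QB2 n r R E" "QB3 n r E" "QB4 n r E"
    using Q_data unfolding Q_polynomial_data_def by blast+
next
  fix i assume "i \<in> {1..n}"
  then show "F i \<noteq> {}" "R i i 0 = Id_on (F i)"
    using F_nonempty labelling unfolding cc_labelling_def by simp_all
next
  fix i j assume ij: "i \<in> {1..n}" "j \<in> {1..n}"
  show "inj_on (R i j) {eps i j..r i j}" "r j i = r i j"
    using ij labelling unfolding cc_labelling_def bij_betw_def by simp_all
  show "partition_on (F i \<times> F j) (R i j ` {eps i j..r i j})"
  proof (rule partition_onI)
    show "\<Union> (R i j ` {eps i j..r i j}) = F i \<times> F j"
    proof
      show "\<Union> (R i j ` {eps i j..r i j}) \<subseteq> F i \<times> F j" unfolding R_image[OF ij] by blast
      show "F i \<times> F j \<subseteq> \<Union> (R i j ` {eps i j..r i j})" using R_cover[OF ij] by blast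
    qed
    show "{} \<notin> R i j ` {eps i j..r i j}"
      unfolding R_image[OF ij] using partition_onD3[OF R_partition] by blast
    fix S T assume "S \<in> R i j ` {eps i j..r i j}" "T \<in> R i j ` {eps i j..r i j}" "S \<noteq> T"
    then show "disjnt S T" unfolding R_image[OF ij] disjnt_iff using R_disjoint by blast
  qed
  fix l assume "l \<in> {eps i j..r i j}"
  then show "(R i j l)\<inverse> = R j i l" using ij labelling unfolding cc_labelling_def by simp
next
  fix i j assume ij: "i \<in> {1..n}" "j \<in> {1..n}" "i \<noteq> j"
  then have "F i \<noteq> F j" using F_inj by (auto dest: inj_onD)
  then have "Id_on (F i) \<noteq> Id_on (F j)" by (metis Domain_Id_on)
  then show "F i \<inter> F j = {}" using R_disjoint[OF Id_fiber[OF ij(1)] Id_fiber[OF ij(2)]] by blast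
qed

section \<open>Basis matrices as polynomials in \<open>E i j 1\<close>\<close>

lemma r_tilde_fiber: "r_tilde r i i = r i i"
  by (simp add: r_tilde_def eps_def)

text \<open>Tridiagonality stops the expansion at \<open>m + 1\<close> and makes the coefficient
  there nonzero. The \<open>min\<close> takes care of the last row, for which index
  \<open>m + 1\<close> does not exist.\<close>

lemma three_term:
  assumes ij: "i \<in> {1..n}" "j \<in> {1..n}" and m: "m \<le> r_tilde r i j" and pos: "1 \<le> r_tilde r i j"
  obtains a where "hadamard (E i j 1) (E i j m) = (\<Sum>k\<le>min (m + 1) (r_tilde r i j). a k *\<^sub>R E i j k)"
    "m < r_tilde r i j \<Longrightarrow> a (m + 1) \<noteq> 0"
proof -
  let ?\<nu> = "1 / sqrt (real (card (F i)) * real (card (F j)))"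
  obtain q where q: "krein_parameters n F r E q" and tri: "irreducible_tridiagonal (q i j 1) (r_tilde r i j)"
    using Q_data ij unfolding Q_polynomial_data_def by blast
  have "hadamard (E i j 1) (E i j m) = ?\<nu> *\<^sub>R (\<Sum>k = 0..r_tilde r i j. q i j 1 m k *\<^sub>R E i j k)"
    using q ij m pos unfolding krein_parameters_def by simp
  also have "\<dots> = ?\<nu> *\<^sub>R (\<Sum>k\<le>min (m + 1) (r_tilde r i j). q i j 1 m k *\<^sub>R E i j k)"
    using tri m unfolding irreducible_tridiagonal_def
    by (intro arg_cong[where f = "\<lambda>v. _ *\<^sub>R v"] sum.mono_neutral_right) auto
  finally have "hadamard (E i j 1) (E i j m) = (\<Sum>k\<le>min (m + 1) (r_tilde r i j). (?\<nu> * q i j 1 m k) *\<^sub>R E i j k)"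
    by (simp add: scaleR_sum_right)
  moreover have "?\<nu> * q i j 1 m (m + 1) \<noteq> 0" if "m < r_tilde r i j"
  proof -
    have "q i j 1 m (m + 1) \<noteq> 0" using tri[unfolded irreducible_tridiagonal_def, rule_format, of m "m + 1"] that by simp
    then show ?thesis using F_nonempty[OF ij(1)] F_nonempty[OF ij(2)] by (simp add: card_eq_0_iff)
  qed
  ultimately show thesis by (rule that)
qed

text \<open>The expansion in \<open>three_term\<close>, solved for its top term.\<close>

lemma E_Suc:
  assumes ij: "i \<in> {1..n}" "j \<in> {1..n}" and m: "m < r_tilde r i j"
  obtains a b where "a \<noteq> 0"
    "E i j (Suc m) = a *\<^sub>R hadamard (E i j 1) (E i j m) - (\<Sum>k\<le>m. b k *\<^sub>R E i j k)"
proof -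
  obtain a where a: "hadamard (E i j 1) (E i j m) = (\<Sum>k\<le>min (m + 1) (r_tilde r i j). a k *\<^sub>R E i j k)"
    "a (m + 1) \<noteq> 0"
    using three_term[OF ij, of m] m by (metis (no_types) Suc_eq_plus1 Suc_leI le_add2 less_imp_le order.trans)
  have "min (m + 1) (r_tilde r i j) = Suc m" using m by simp
  then have "E i j (Suc m) = inverse (a (m + 1)) *\<^sub>R hadamard (E i j 1) (E i j m)
      - (\<Sum>k\<le>m. (inverse (a (m + 1)) * a k) *\<^sub>R E i j k)"
    using a by (simp add: algebra_simps scaleR_sum_right)
  then show thesis using a(2) by (intro that[of "inverse (a (m + 1))"]) auto
qed

text \<open>Induction along \<open>E_Suc\<close>: the entrywise product with \<open>E i j 1\<close>
  raises the degree by exactly one, and the subtracted terms have lower degree.\<close>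

lemma E_poly:
  assumes ij: "i \<in> {1..n}" "j \<in> {1..n}" and k: "k \<le> r_tilde r i j"
  shows "\<exists>p. p \<noteq> 0 \<and> degree p = k \<and> (\<forall>x\<in>F i. \<forall>y\<in>F j. E i j k $ x $ y = poly p (E i j 1 $ x $ y))"
  using k
proof (induction k rule: less_induct)
  case (less k)
  show ?case
  proof (cases k)
    case 0
    then show ?thesis using E_0_nth[OF ij] F_nonempty[OF ij(1)] F_nonempty[OF ij(2)]
      by (intro exI[of _ "[:1 / sqrt (real (card (F i)) * real (card (F j))):]"]) (auto simp: card_eq_0_iff)
  next
    case (Suc m)
    have "\<exists>P. \<forall>l\<le>m. P l \<noteq> 0 \<and> degree (P l) = l \<and>
        (\<forall>x\<in>F i. \<forall>y\<in>F j. E i j l $ x $ y = poly (P l) (E i j 1 $ x $ y))"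
      using less Suc by (intro choice) auto
    then obtain P where P: "\<And>l. l \<le> m \<Longrightarrow> P l \<noteq> 0" "\<And>l. l \<le> m \<Longrightarrow> degree (P l) = l"
      and val: "\<And>l x y. l \<le> m \<Longrightarrow> x \<in> F i \<Longrightarrow> y \<in> F j \<Longrightarrow> E i j l $ x $ y = poly (P l) (E i j 1 $ x $ y)"
      by blast
    obtain a b where a: "a \<noteq> 0" and ab:
      "E i j (Suc m) = a *\<^sub>R hadamard (E i j 1) (E i j m) - (\<Sum>l\<le>m. b l *\<^sub>R E i j l)"
      using E_Suc[OF ij, of m] less.prems Suc by auto
    let ?lead = "smult a (pCons 0 (P m))" and ?low = "\<Sum>l\<le>m. smult (b l) (P l)"
    have lead: "degree ?lead = Suc m" using P[of m] a by simp
    have "degree ?low \<le> m"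
      by (rule degree_sum_le) (use P in \<open>auto intro: order.trans[OF degree_smult_le]\<close>)
    then have deg: "degree (?lead - ?low) = Suc m"
      unfolding diff_conv_add_uminus using lead by (subst degree_add_eq_left) simp_all
    moreover have "?lead - ?low \<noteq> 0" using deg by (metis degree_0 nat.distinct(1))
    moreover have "E i j (Suc m) $ x $ y = poly (?lead - ?low) (E i j 1 $ x $ y)"
      if xy: "x \<in> F i" "y \<in> F j" for x y
    proof -
      have "E i j (Suc m) $ x $ y = a * (E i j 1 $ x $ y * E i j m $ x $ y) - (\<Sum>l\<le>m. b l * E i j l $ x $ y)"
        unfolding ab by (simp add: hadamard_def)
      also have "\<dots> = a * (E i j 1 $ x $ y * poly (P m) (E i j 1 $ x $ y))
          - (\<Sum>l\<le>m. b l * poly (P l) (E i j 1 $ x $ y))"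
        by (intro arg_cong2[where f = minus] arg_cong2[where f = times] sum.cong refl val xy) simp_all
      finally show ?thesis by (simp add: poly_sum)
    qed
    ultimately show ?thesis unfolding Suc by blast
  qed
qed

text \<open>By \<open>E_poly\<close>, equal values of \<open>E i j 1\<close> force equal values of
  every matrix in the block space, in particular of the adjacency matrix of
  \<open>R i j a\<close>.\<close>

lemma E_1_separates:
  assumes ij: "i \<in> {1..n}" "j \<in> {1..n}"
    and a: "a \<in> {eps i j..r i j}" "(x, y) \<in> R i j a" and b: "b \<in> {eps i j..r i j}" "(x', y') \<in> R i j b"
    and eq: "E i j 1 $ x $ y = E i j 1 $ x' $ y'"
  shows "a = b"
proof -
  have F: "x \<in> F i" "y \<in> F j" "x' \<in> F i" "y' \<in> F j"
    using rel_subset[OF ij a(1)] rel_subset[OF ij b(1)] a(2) b(2) by auto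
  have "E i j ` {0..r_tilde r i j} \<subseteq> {M. M $ x $ y = M $ x' $ y'}"
  proof
    fix M assume "M \<in> E i j ` {0..r_tilde r i j}"
    then obtain k where k: "k \<le> r_tilde r i j" "M = E i j k" by auto
    then show "M \<in> {M. M $ x $ y = M $ x' $ y'}" using E_poly[OF ij k(1)] F eq by auto
  qed
  then have "block_space r R i j \<subseteq> {M. M $ x $ y = M $ x' $ y'}"
    unfolding E_span[OF ij, symmetric] by (rule span_minimal) (auto simp: subspace_def)
  then have "adjacency_matrix (R i j a) $ x $ y = (adjacency_matrix (R i j a) :: real^'a^'a) $ x' $ y'"
    using adjacency_in_block[OF a(1)] by blast
  then have "(x', y') \<in> R i j a" using a(2) by (simp add: adjacency_matrix_def split: if_splits)
  then show "a = b" using rel_unique[OF ij a(1) b(1)] b(2) by blast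
qed

text \<open>By \<open>E_1_separates\<close>, the relations in \<open>L\<close> supply
  \<open>card L\<close> distinct roots, more than the degree allows for a nonzero
  polynomial.\<close>

lemma poly_eq_0_of_relations:
  assumes ij: "i \<in> {1..n}" "j \<in> {1..n}" and L: "L \<subseteq> {eps i j..r i j}"
    and van: "\<And>l. l \<in> L \<Longrightarrow> \<exists>(x, y)\<in>R i j l. poly p (E i j 1 $ x $ y) = 0"
    and deg: "degree p < card L"
  shows "p = 0"
proof (rule ccontr)
  assume p: "p \<noteq> 0"
  have "\<exists>w. w \<in> R i j l \<and> poly p (E i j 1 $ fst w $ snd w) = 0" if l: "l \<in> L" for l
  proof -
    obtain x y where "(x, y) \<in> R i j l" "poly p (E i j 1 $ x $ y) = 0" using van[OF l] by blast
    then show ?thesis by (intro exI[of _ "(x, y)"]) simp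
  qed
  then obtain g where g: "\<And>l. l \<in> L \<Longrightarrow> g l \<in> R i j l \<and> poly p (E i j 1 $ fst (g l) $ snd (g l)) = 0"
    by metis
  let ?\<theta> = "\<lambda>l. E i j 1 $ fst (g l) $ snd (g l)"
  have "inj_on ?\<theta> L"
  proof (rule inj_onI)
    fix a b assume ab: "a \<in> L" "b \<in> L" "?\<theta> a = ?\<theta> b"
    show "a = b"
      by (rule E_1_separates[OF ij, of a "fst (g a)" "snd (g a)" b "fst (g b)" "snd (g b)"])
        (use ab g L in auto)
  qed
  then have "card L = card (?\<theta> ` L)" by (simp add: card_image)
  also have "\<dots> \<le> card {x. poly p x = 0}"
    by (rule card_mono) (use p poly_roots_finite g in auto)
  also have "\<dots> \<le> degree p" using p by (rule card_poly_roots_bound)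
  finally show False using deg by simp
qed

section \<open>Degree bound for entrywise products\<close>

lemma hadamard_1_span:
  assumes ij: "i \<in> {1..n}" "j \<in> {1..n}" and pos: "1 \<le> r_tilde r i j"
    and M: "M \<in> span (E i j ` {..min k (r_tilde r i j)})"
  shows "hadamard (E i j 1) M \<in> span (E i j ` {..min (Suc k) (r_tilde r i j)})"
  using M
proof (induction rule: span_induct)
  show "subspace {M. hadamard (E i j 1) M \<in> span (E i j ` {..min (Suc k) (r_tilde r i j)})}"
    using linear_subspace_vimage[OF linear_hadamard subspace_span] by (simp add: vimage_def)
next
  fix M assume "M \<in> E i j ` {..min k (r_tilde r i j)}"
  then obtain m where m: "m \<le> k" "m \<le> r_tilde r i j" "M = E i j m" by auto
  obtain a where a: "hadamard (E i j 1) (E i j m) = (\<Sum>k\<le>min (m + 1) (r_tilde r i j). a k *\<^sub>R E i j k)"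
    using three_term[OF ij m(2) pos] by blast
  show "hadamard (E i j 1) M \<in> span (E i j ` {..min (Suc k) (r_tilde r i j)})"
    unfolding m(3) a by (intro span_sum span_scale span_base imageI) (use m(1) in simp)
qed

text \<open>In other words, the Krein parameters vanish for a third index above
  \<open>l + m\<close>. Induction on \<open>l\<close> by \<open>E_Suc\<close>, as the entrywise
  product with \<open>E i j 1\<close> raises the top index by at most one.\<close>

lemma hadamard_span:
  assumes ij: "i \<in> {1..n}" "j \<in> {1..n}" and "l \<le> r_tilde r i j" and m: "m \<le> r_tilde r i j"
  shows "hadamard (E i j l) (E i j m) \<in> span (E i j ` {..min (l + m) (r_tilde r i j)})"
  using assms(3)
proof (induction l rule: less_induct)
  case (less l)
  show ?case
  proof (cases l)
    case 0
    have "hadamard (E i j 0) (E i j m) = (1 / sqrt (real (card (F i)) * real (card (F j)))) *\<^sub>R E i j m"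
      by (rule hadamard_E_0[OF ij E_in_block[OF ij m]])
    moreover have "E i j m \<in> span (E i j ` {..min (l + m) (r_tilde r i j)})"
      using 0 m by (intro span_base) simp
    ultimately show ?thesis unfolding 0 by (simp only: span_scale)
  next
    case (Suc l')
    obtain a b where ab:
      "E i j l = a *\<^sub>R hadamard (E i j 1) (E i j l') - (\<Sum>k\<le>l'. b k *\<^sub>R E i j k)"
      using E_Suc[OF ij, of l'] less.prems Suc by (metis Suc_le_lessD)
    have "hadamard (E i j l) (E i j m) = a *\<^sub>R hadamard (E i j 1) (hadamard (E i j l') (E i j m))
        - (\<Sum>k\<le>l'. b k *\<^sub>R hadamard (E i j k) (E i j m))"
      unfolding ab by (simp add: vec_eq_iff hadamard_def algebra_simps sum_distrib_left sum_distrib_right)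
    moreover have "hadamard (E i j 1) (hadamard (E i j l') (E i j m)) \<in> span (E i j ` {..min (l + m) (r_tilde r i j)})"
      using hadamard_1_span[OF ij _ less.IH[of l']] less.prems Suc by simp
    moreover have "hadamard (E i j k) (E i j m) \<in> span (E i j ` {..min (l + m) (r_tilde r i j)})" if "k \<le> l'" for k
    proof -
      have "hadamard (E i j k) (E i j m) \<in> span (E i j ` {..min (k + m) (r_tilde r i j)})"
        using less.IH[of k] less.prems Suc that by simp
      moreover have "span (E i j ` {..min (k + m) (r_tilde r i j)}) \<subseteq> span (E i j ` {..min (l + m) (r_tilde r i j)})"
        using that Suc by (intro span_mono image_mono) auto
      ultimately show ?thesis by blast
    qed
    ultimately show ?thesis by (auto intro!: span_diff span_sum span_scale)
  qed
qed

text \<open>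
  The sum of the squares of the entries of \<open>A D B\<close>, where \<open>A = E i j l\<close>, \<open>B = E j h m\<close> and \<open>D\<close> is the
  diagonal matrix of \<open>w\<close>, is the quadratic form of \<open>hadamard (A\<^sup>T A) (B B\<^sup>T)\<close> at \<open>w\<close>.
\<close>

lemma weighted_product_eq_0:
  assumes ijh: "i \<in> {1..n}" "j \<in> {1..n}" "h \<in> {1..n}"
    and l: "l \<le> r_tilde r i j" and m: "m \<le> r_tilde r j h" and k: "k \<le> r j j" "l + m < k"
  shows "(\<Sum>z\<in>UNIV. E i j l $ x $ z * (E j j k *v v) $ z * E j h m $ z $ y) = 0"
proof -
  define w where "w = E j j k *v v"
  define N where "N x y = (\<Sum>z\<in>UNIV. E i j l $ x $ z * w $ z * E j h m $ z $ y)" for x y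
  let ?H = "hadamard (E j j l) (E j j m)"
  have lm: "l \<le> r_tilde r j j" "m \<le> r_tilde r j j"
    using l m r_tilde_le_fiber[OF ijh(1,2)] r_tilde_le_fiber[OF ijh(2,3)] by auto
  \<comment> \<open>By \<open>QB3\<close> and \<open>QB4\<close>, \<open>E j j l\<close> is the Gram
    matrix of the columns of \<open>E i j l\<close>, and \<open>E j j m\<close> that of the rows of
    \<open>E j h m\<close>.\<close>
  have L: "E j j l $ z $ z' = (\<Sum>x\<in>UNIV. E i j l $ x $ z * E i j l $ x $ z')" for z z'
    using E_mult[OF ijh(2,1,2), of l l] E_transpose[OF ijh(1,2) l] l r_tilde_sym[OF ijh(1,2)]
    by (simp add: matrix_mul_nth transpose_def vec_eq_iff)
  have M: "E j j m $ z $ z' = (\<Sum>y\<in>UNIV. E j h m $ z $ y * E j h m $ z' $ y)" for z z'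
    using E_mult[OF ijh(2,3,2), of m m] E_transpose[OF ijh(2,3) m] m r_tilde_sym[OF ijh(2,3)]
    by (simp add: matrix_mul_nth transpose_def vec_eq_iff)
  have "(\<Sum>x\<in>UNIV. \<Sum>y\<in>UNIV. (N x y)\<^sup>2) = (\<Sum>x\<in>UNIV. \<Sum>y\<in>UNIV. \<Sum>z\<in>UNIV. \<Sum>z'\<in>UNIV.
      w $ z * w $ z' * (E i j l $ x $ z * E i j l $ x $ z') * (E j h m $ z $ y * E j h m $ z' $ y))"
    unfolding N_def power2_eq_square sum_product by (intro sum.cong refl) (simp add: algebra_simps)
  also have "\<dots> = (\<Sum>x\<in>UNIV. \<Sum>z\<in>UNIV. \<Sum>z'\<in>UNIV. \<Sum>y\<in>UNIV.
      w $ z * w $ z' * (E i j l $ x $ z * E i j l $ x $ z') * (E j h m $ z $ y * E j h m $ z' $ y))"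
    by (subst (2) sum.swap, subst (3) sum.swap) (rule refl)
  also have "\<dots> = (\<Sum>x\<in>UNIV. \<Sum>z\<in>UNIV. \<Sum>z'\<in>UNIV.
      w $ z * w $ z' * E j j m $ z $ z' * (E i j l $ x $ z * E i j l $ x $ z'))"
    unfolding M sum_distrib_left sum_distrib_right by (intro sum.cong refl) (simp add: algebra_simps)
  also have "\<dots> = (\<Sum>z\<in>UNIV. \<Sum>z'\<in>UNIV. \<Sum>x\<in>UNIV.
      w $ z * w $ z' * E j j m $ z $ z' * (E i j l $ x $ z * E i j l $ x $ z'))"
    by (subst (1) sum.swap, subst (2) sum.swap) (rule refl)
  also have "\<dots> = (\<Sum>z\<in>UNIV. \<Sum>z'\<in>UNIV. w $ z * (?H $ z $ z' * w $ z'))"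
    unfolding hadamard_def L by (intro sum.cong refl) (simp add: sum_distrib_left algebra_simps)
  also have "\<dots> = w \<bullet> (?H *v w)"
    by (simp add: inner_vec_def matrix_vector_mult_def sum_distrib_left)
  \<comment> \<open>By \<open>hadamard_span\<close>, \<open>?H\<close> is a combination of matrices
    \<open>E j j a\<close> with \<open>a \<le> l + m < k\<close>, each of which annihilates
    \<open>E j j k\<close>.\<close>
  also have "?H *v w = 0"
    using hadamard_span[OF ijh(2,2) lm]
  proof (induction rule: span_induct)
    show "subspace {M. M *v w = 0}"
      by (auto simp: subspace_def matrix_vector_mult_add_rdistrib scaleR_matrix_vector_assoc[symmetric])
  next
    fix M assume "M \<in> E j j ` {..min (l + m) (r_tilde r j j)}"
    then obtain a where a: "a \<le> l + m" "a \<le> r_tilde r j j" "M = E j j a" by auto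
    then have "M ** E j j k = 0" using E_mult[OF ijh(2,2,2) a(2), of k] k by (simp add: r_tilde_fiber)
    then show "M *v w = 0" by (simp add: w_def matrix_vector_mul_assoc)
  qed
  finally have "\<forall>x\<in>UNIV. (\<Sum>y\<in>UNIV. (N x y)\<^sup>2) = 0"
    by (subst (asm) inner_zero_right, subst (asm) sum_nonneg_eq_0_iff) (auto intro: sum_nonneg)
  then have "(N x y)\<^sup>2 = 0" by (simp add: sum_nonneg_eq_0_iff)
  then show ?thesis by (simp add: N_def w_def)
qed

section \<open>Idempotents of a fiber and sums over a design\<close>

lemma sum_E_fiber:
  assumes j: "j \<in> {1..n}"
  shows "(\<Sum>k\<le>r j j. E j j k) = adjacency_matrix (Id_on (F j))"
proof (rule sum_orthogonal_idempotents)
  show "adjacency_matrix (Id_on (F j)) \<in> span (E j j ` {..r j j})"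
    using adjacency_in_block[of 0 j j] rel_diag[OF j] E_span[OF j j]
    by (simp add: eps_def r_tilde_fiber atLeast0AtMost)
next
  fix k m assume "k \<le> r j j" "m \<le> r j j"
  then show "E j j k ** E j j m = (if k = m then E j j k else 0)"
    by (intro E_mult j) (simp_all add: r_tilde_fiber)
next
  fix k assume "k \<le> r j j"
  then have k: "k \<le> r_tilde r j j" by (simp add: r_tilde_fiber)
  show "E j j k \<noteq> 0" by (rule E_nonzero[OF j j k])
  show "E j j k ** adjacency_matrix (Id_on (F j)) = E j j k"
    by (rule matrix_mul_Id_on) (use block_space_support[OF E_in_block[OF j j k] j j] in blast)
qed

text \<open>The diagonal is one relation, so \<open>E i i k\<close> is constant on it. Since
  \<open>E i i k = E i i k ** transpose (E i i k)\<close>, its diagonal entries are the squared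
  norms of its rows; if one were 0, the whole matrix would be 0.\<close>

lemma E_diagonal_nonzero:
  assumes i: "i \<in> {1..n}" and k: "k \<le> r i i" and x: "x \<in> F i"
  shows "E i i k $ x $ x \<noteq> 0"
proof
  assume 0: "E i i k $ x $ x = 0"
  have k': "k \<le> r_tilde r i i" using k by (simp add: r_tilde_fiber)
  have "E i i k $ a $ b = 0" for a b
  proof (cases "a \<in> F i")
    case True
    have "(a, a) \<in> R i i 0" "(x, x) \<in> R i i 0" using rel_diag[OF i] True x by auto
    then have "E i i k $ a $ a = 0"
      using block_space_const[OF E_in_block[OF i i k'] i i, of 0 a a x x] 0 by (simp add: eps_def)
    moreover have "E i i k $ a $ a = (\<Sum>z\<in>UNIV. (E i i k $ a $ z)\<^sup>2)"
    proof -
      have "E i i k = E i i k ** transpose (E i i k)"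
        using E_mult[OF i i i k' k'] E_transpose[OF i i k'] by metis
      then have "E i i k $ a $ a = (E i i k ** transpose (E i i k)) $ a $ a" by metis
      then show ?thesis unfolding matrix_mul_nth transpose_def vec_lambda_beta power2_eq_square .
    qed
    ultimately show ?thesis by (simp add: sum_nonneg_eq_0_iff)
  next
    case False
    then show ?thesis using block_space_support[OF E_in_block[OF i i k'] i i] by blast
  qed
  then show False using E_nonzero[OF i i k'] by (simp add: vec_eq_iff)
qed

text \<open>Split \<open>char_vec A\<close> into its components
  \<open>E j j k *v char_vec A\<close>. Those with \<open>1 \<le> k \<le> t\<close> vanish by the
  design property, those with \<open>k > t \<ge> l + m\<close> contribute nothing by
  \<open>weighted_product_eq_0\<close>, and the component for \<open>k = 0\<close> has the constant
  value \<open>card A / card (F j)\<close> on \<open>F j\<close>.\<close>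

lemma design_product:
  assumes ijh: "i \<in> {1..n}" "j \<in> {1..n}" "h \<in> {1..n}"
    and l: "l \<le> r_tilde r i j" and m: "m \<le> r_tilde r j h"
    and design: "t_design (F j) (r j j) (E j j) t A" and t: "l + m \<le> t"
  shows "(\<Sum>z\<in>A. E i j l $ x $ z * E j h m $ z $ y) =
    (if l = m then real (card A) / real (card (F j)) * E i h l $ x $ y else 0)"
proof -
  let ?\<chi> = "char_vec A :: real^'a"
  let ?S = "\<lambda>k. \<Sum>z\<in>UNIV. E i j l $ x $ z * (E j j k *v ?\<chi>) $ z * E j h m $ z $ y"
  have A: "A \<subseteq> F j" using design by (simp add: t_design_def)
  have \<chi>: "?\<chi> $ z = (\<Sum>k\<le>r j j. (E j j k *v ?\<chi>) $ z)" if "z \<in> F j" for z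
  proof -
    have "(\<Sum>k\<le>r j j. (E j j k *v ?\<chi>) $ z) = ((\<Sum>k\<le>r j j. E j j k) *v ?\<chi>) $ z"
      by (simp add: matrix_vector_mult_def sum_distrib_right sum_distrib_left) (rule sum.swap)
    also have "\<dots> = (\<Sum>u\<in>UNIV. if u = z then ?\<chi> $ u else 0)"
      unfolding sum_E_fiber[OF ijh(2)] matrix_vector_mult_def adjacency_matrix_def
      using that by (simp del: sum.delta sum.delta') (intro sum.cong, auto)
    finally show ?thesis by simp
  qed
  have "(\<Sum>z\<in>A. E i j l $ x $ z * E j h m $ z $ y) = (\<Sum>z\<in>UNIV. E i j l $ x $ z * ?\<chi> $ z * E j h m $ z $ y)"
    by (intro sum.mono_neutral_cong_left) (simp_all add: char_vec_def)
  also have "\<dots> = (\<Sum>z\<in>UNIV. \<Sum>k\<le>r j j. E i j l $ x $ z * (E j j k *v ?\<chi>) $ z * E j h m $ z $ y)"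
  proof (rule sum.cong)
    fix z
    show "E i j l $ x $ z * ?\<chi> $ z * E j h m $ z $ y =
      (\<Sum>k\<le>r j j. E i j l $ x $ z * (E j j k *v ?\<chi>) $ z * E j h m $ z $ y)"
    proof (cases "z \<in> F j")
      case True
      show ?thesis unfolding \<chi>[OF True] sum_distrib_left sum_distrib_right by (rule refl)
    next
      case False
      then have "E i j l $ x $ z = 0" using block_space_support[OF E_in_block[OF ijh(1,2) l] ijh(1,2)] by blast
      then show ?thesis by simp
    qed
  qed simp
  also have "\<dots> = (\<Sum>k\<le>r j j. ?S k)" by (rule sum.swap)
  also have "\<dots> = (\<Sum>k\<in>{0}. ?S k)"
  proof (rule sum.mono_neutral_right)
    show "\<forall>k\<in>{..r j j} - {0}. ?S k = 0"
    proof
      fix k assume k: "k \<in> {..r j j} - {0}"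
      show "?S k = 0"
      proof (cases "k \<le> t")
        case True
        then have "E j j k *v ?\<chi> = 0" using design k by (simp add: t_design_def)
        then show ?thesis by simp
      next
        case False
        then show ?thesis using weighted_product_eq_0[OF ijh l m, of k] k t by simp
      qed
    qed
  qed auto
  also have "\<dots> = ?S 0" by simp
  also have "\<dots> = (\<Sum>z\<in>UNIV. real (card A) / real (card (F j)) * (E i j l $ x $ z * E j h m $ z $ y))"
  proof (rule sum.cong)
    fix z
    show "E i j l $ x $ z * (E j j 0 *v ?\<chi>) $ z * E j h m $ z $ y =
      real (card A) / real (card (F j)) * (E i j l $ x $ z * E j h m $ z $ y)"
    proof (cases "z \<in> F j")
      case True
      have "(E j j 0 *v ?\<chi>) $ z = (\<Sum>u\<in>A. E j j 0 $ z $ u)"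
        unfolding matrix_vector_mult_def
        by (simp, rule sum.mono_neutral_cong_right) (auto simp: char_vec_def)
      also have "\<dots> = (\<Sum>u\<in>A. 1 / real (card (F j)))"
        using True A by (intro sum.cong) (auto simp: E_0_nth[OF ijh(2,2)])
      finally show ?thesis by simp
    next
      case False
      then have "E i j l $ x $ z = 0" using block_space_support[OF E_in_block[OF ijh(1,2) l] ijh(1,2)] by blast
      then show ?thesis by simp
    qed
  qed simp
  also have "\<dots> = real (card A) / real (card (F j)) * (E i j l ** E j h m) $ x $ y"
    by (simp add: matrix_mul_nth sum_distrib_left)
  finally show ?thesis using E_mult[OF ijh l m] by simp
qed

end

section \<open>Families of designs\<close>

text \<open>The chosen enumeration depends on the set alone. So the pairs \<open>(i, j)\<close> and
  \<open>(j, i)\<close>, whose sets of labels coincide, are enumerated alike, as converse relations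
  require.\<close>

definition enumeration :: "nat set \<Rightarrow> nat \<Rightarrow> nat" where
  "enumeration A = (SOME f. bij_betw f {1..card A} A)"

lemma bij_betw_enumeration: "finite A \<Longrightarrow> bij_betw (enumeration A) {1..card A} A"
  unfolding enumeration_def by (rule someI_ex[OF ex_bij_betw_nat_finite_1])

definition restrict_matrix :: "'a set \<Rightarrow> 'a set \<Rightarrow> real^'a^'a \<Rightarrow> real^'a^'a::finite" where
  "restrict_matrix A B M = (\<chi> x y. if x \<in> A \<and> y \<in> B then M $ x $ y else 0)"

lemma linear_restrict_matrix: "linear (restrict_matrix A B)"
  by (rule linearI) (simp_all add: restrict_matrix_def vec_eq_iff)

lemma restrict_matrix_nth:
  "restrict_matrix A B M $ x $ y = (if x \<in> A \<and> y \<in> B then M $ x $ y else 0)"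
  by (simp add: restrict_matrix_def)

lemma restrict_adjacency_matrix:
  "restrict_matrix A B (adjacency_matrix T) = adjacency_matrix (T \<inter> (A \<times> B))"
  by (simp add: restrict_matrix_def adjacency_matrix_def vec_eq_iff)

locale design_family = Q_configuration X \<R> n F r R E
  for X :: "'a::finite set" and \<R> :: "('a \<times> 'a) set set"
    and n :: nat and F :: "nat \<Rightarrow> 'a set" and r :: "nat \<Rightarrow> nat \<Rightarrow> nat"
    and R :: "nat \<Rightarrow> nat \<Rightarrow> nat \<Rightarrow> ('a \<times> 'a) set"
    and E :: "nat \<Rightarrow> nat \<Rightarrow> nat \<Rightarrow> real^'a^'a" +
  fixes Y :: "nat \<Rightarrow> 'a set" and t :: "nat \<Rightarrow> nat"
  assumes design: "i \<in> {1..n} \<Longrightarrow> t_design (F i) (r i i) (E i i) (t i) (Y i)"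
    and degrees: "i \<in> {1..n} \<Longrightarrow> j \<in> {1..n} \<Longrightarrow> h \<in> {1..n} \<Longrightarrow>
      int (degree_between r R Y i j) + int (degree_between r R Y j h) - 2 \<le> int (t j)"
begin

section \<open>Labelled relations between the designs\<close>

definition s :: "nat \<Rightarrow> nat \<Rightarrow> nat" where
  "s i j = degree_between r R Y i j"

definition L :: "nat \<Rightarrow> nat \<Rightarrow> nat set" where
  "L i j = {l \<in> {1..r i j}. R i j l \<inter> (Y i \<times> Y j) \<noteq> {}}"

text \<open>Label 0 is kept for the diagonal relation of a fiber; positive labels run through
  \<open>L i j\<close>.\<close>

definition lab :: "nat \<Rightarrow> nat \<Rightarrow> nat \<Rightarrow> nat" where
  "lab i j k = (if k = 0 then 0 else enumeration (L i j) k)"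

definition S :: "nat \<Rightarrow> nat \<Rightarrow> nat \<Rightarrow> ('a \<times> 'a) set" where
  "S i j k = R i j (lab i j k) \<inter> (Y i \<times> Y j)"

lemma card_L: "card (L i j) = s i j"
  by (simp add: L_def s_def degree_between_def)

lemma finite_L: "finite (L i j)"
  by (simp add: L_def)

lemma Y_nonempty: "i \<in> {1..n} \<Longrightarrow> Y i \<noteq> {}" and Y_subset: "i \<in> {1..n} \<Longrightarrow> Y i \<subseteq> F i"
  using design by (auto simp: t_design_def)

lemma R_restrict_0: "i \<in> {1..n} \<Longrightarrow> R i i 0 \<inter> (Y i \<times> Y i) = Id_on (Y i)"
  using rel_diag[of i] Y_subset[of i] by auto

lemma L_sym:
  assumes ij: "i \<in> {1..n}" "j \<in> {1..n}"
  shows "L j i = L i j"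
proof -
  have "R j i l \<inter> (Y j \<times> Y i) \<noteq> {} \<longleftrightarrow> R i j l \<inter> (Y i \<times> Y j) \<noteq> {}" if "l \<in> {1..r i j}" for l
  proof -
    have "l \<in> {eps i j..r i j}" using that by (auto simp: eps_def)
    then have "R j i l = (R i j l)\<inverse>" using rel_converse[OF ij] by simp
    then show ?thesis by blast
  qed
  then show ?thesis unfolding L_def num_sym[OF ij] by blast
qed

lemma lab_sym: "i \<in> {1..n} \<Longrightarrow> j \<in> {1..n} \<Longrightarrow> lab j i = lab i j"
  by (simp add: lab_def L_sym fun_eq_iff)

lemma bij_lab:
  assumes ij: "i \<in> {1..n}" "j \<in> {1..n}"
  shows "bij_betw (lab i j) {eps i j..s i j} {l \<in> {eps i j..r i j}. R i j l \<inter> (Y i \<times> Y j) \<noteq> {}}"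
proof -
  have bij: "bij_betw (lab i j) {1..s i j} (L i j)"
    using bij_betw_enumeration[OF finite_L[of i j]] unfolding card_L
    by (rule bij_betw_cong[THEN iffD1, rotated]) (simp add: lab_def)
  show ?thesis
  proof (cases "i = j")
    case False
    then show ?thesis using bij by (simp add: eps_def L_def)
  next
    case True
    have "bij_betw (lab i j) (insert 0 {1..s i j}) (insert 0 (L i j))"
      using notIn_Un_bij_betw[OF _ _ bij, of 0] by (simp add: lab_def L_def)
    moreover have "insert 0 {1..s i j} = {0..s i j}" by auto
    moreover have "insert 0 (L i j) = {l \<in> {0..r i j}. R i j l \<inter> (Y i \<times> Y j) \<noteq> {}}"
      using R_restrict_0[OF ij(1)] Y_nonempty[OF ij(1)] True by (auto simp: L_def Suc_le_eq)
    ultimately show ?thesis using True by (simp add: eps_def)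
  qed
qed

lemma lab_in:
  assumes "i \<in> {1..n}" "j \<in> {1..n}" "k \<in> {eps i j..s i j}"
  shows "lab i j k \<in> {eps i j..r i j}" and "S i j k \<noteq> {}"
  using bij_betwE[OF bij_lab[OF assms(1,2)]] assms(3) by (auto simp: S_def)

sublocale sub: labelled_partition n Y s S
proof
  show "n \<ge> 1" by (rule n_pos)
next
  fix i assume i: "i \<in> {1..n}"
  show "Y i \<noteq> {}" by (rule Y_nonempty[OF i])
  show "S i i 0 = Id_on (Y i)" using R_restrict_0[OF i] by (simp add: S_def lab_def)
next
  fix i j assume ij: "i \<in> {1..n}" "j \<in> {1..n}" "i \<noteq> j"
  then show "Y i \<inter> Y j = {}" using fiber_disjoint[OF ij] Y_subset by blast
next
  fix i j assume ij: "i \<in> {1..n}" "j \<in> {1..n}"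
  have inj: "k = k'" if k: "k \<in> {eps i j..s i j}" "k' \<in> {eps i j..s i j}" "p \<in> S i j k" "p \<in> S i j k'" for k k' p
  proof -
    have "p \<in> R i j (lab i j k)" "p \<in> R i j (lab i j k')" using k(3,4) by (auto simp: S_def)
    then have "lab i j k = lab i j k'" using rel_unique[OF ij lab_in(1)[OF ij k(1)] lab_in(1)[OF ij k(2)]] by blast
    then show ?thesis using bij_betw_imp_inj_on[OF bij_lab[OF ij]] k(1,2) by (auto dest: inj_onD)
  qed
  show "inj_on (S i j) {eps i j..s i j}"
  proof (rule inj_onI)
    fix k k' assume k: "k \<in> {eps i j..s i j}" "k' \<in> {eps i j..s i j}" and eq: "S i j k = S i j k'"
    obtain p where "p \<in> S i j k" using lab_in(2)[OF ij k(1)] by blast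
    then show "k = k'" using inj[OF k, of p] eq by simp
  qed
  show "partition_on (Y i \<times> Y j) (S i j ` {eps i j..s i j})"
  proof (rule partition_onI)
    show "\<Union> (S i j ` {eps i j..s i j}) = Y i \<times> Y j"
    proof
      show "\<Union> (S i j ` {eps i j..s i j}) \<subseteq> Y i \<times> Y j" by (auto simp: S_def)
      show "Y i \<times> Y j \<subseteq> \<Union> (S i j ` {eps i j..s i j})"
      proof
        fix p assume p: "p \<in> Y i \<times> Y j"
        then obtain x y where xy: "p = (x, y)" "x \<in> F i" "y \<in> F j" using Y_subset ij by blast
        then obtain l where l: "l \<in> {eps i j..r i j}" "p \<in> R i j l" using R_cover[OF ij] by blast
        then have "l \<in> lab i j ` {eps i j..s i j}"
          using p unfolding bij_betw_imp_surj_on[OF bij_lab[OF ij]] by blast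
        then show "p \<in> \<Union> (S i j ` {eps i j..s i j})" using l(2) p unfolding S_def by blast
      qed
    qed
    show "{} \<notin> S i j ` {eps i j..s i j}" using lab_in(2)[OF ij] by blast
    fix A B assume "A \<in> S i j ` {eps i j..s i j}" "B \<in> S i j ` {eps i j..s i j}" "A \<noteq> B"
    then show "disjnt A B" unfolding disjnt_iff using inj by blast
  qed
  show "s j i = s i j" using L_sym[OF ij] card_L by metis
  fix k assume k: "k \<in> {eps i j..s i j}"
  show "(S i j k)\<inverse> = S j i k"
    using rel_converse[OF ij lab_in(1)[OF ij k]] lab_sym[OF ij] by (auto simp: S_def)
qed

lemma relations_eq_induced: "sub.relations = induced_relations n r R Y"
proof
  show "sub.relations \<subseteq> induced_relations n r R Y"
  proof
    fix T assume "T \<in> sub.relations"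
    then obtain i j k where ij: "i \<in> {1..n}" "j \<in> {1..n}" "k \<in> {eps i j..s i j}" "T = S i j k"
      by (rule sub.relationsE)
    show "T \<in> induced_relations n r R Y"
    proof (cases "lab i j k = 0")
      case True
      \<comment> \<open>The old label 0 is in range only if \<open>eps i j = 0\<close>.\<close>
      then have "i = j" using lab_in(1)[OF ij(1-3)] by (auto simp: eps_def split: if_splits)
      then have "T = Id_on (Y i)" using R_restrict_0[OF ij(1)] True ij(4) by (simp add: S_def)
      then show ?thesis using ij(1) unfolding induced_relations_def by blast
    next
      case False
      then have "lab i j k \<in> {1..r i j}" using lab_in(1)[OF ij(1-3)] by auto
      then show ?thesis using ij(1,2,4) lab_in(2)[OF ij(1-3)] unfolding induced_relations_def S_def by blast
    qed
  qed
  show "induced_relations n r R Y \<subseteq> sub.relations"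
  proof
    fix T assume "T \<in> induced_relations n r R Y"
    then consider (diag) i where "i \<in> {1..n}" "T = Id_on (Y i)"
      | (rel) i j l where "i \<in> {1..n}" "j \<in> {1..n}" "l \<in> {1..r i j}" "T = R i j l \<inter> (Y i \<times> Y j)"
        "R i j l \<inter> (Y i \<times> Y j) \<noteq> {}"
      unfolding induced_relations_def by blast
    then show "T \<in> sub.relations"
    proof cases
      case diag
      then show ?thesis using sub.relationsI[of i i 0] sub.rel_diag[of i] by (simp add: eps_def)
    next
      case rel
      then have "l \<in> {eps i j..r i j}" by (auto simp: eps_def)
      then have "l \<in> lab i j ` {eps i j..s i j}"
        using rel(5) unfolding bij_betw_imp_surj_on[OF bij_lab[OF rel(1,2)]] by blast
      then obtain k where "k \<in> {eps i j..s i j}" "l = lab i j k" by blast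
      then show ?thesis using sub.relationsI[OF rel(1,2)] rel(4) by (simp add: S_def)
    qed
  qed
qed

section \<open>Restricted and rescaled basis matrices\<close>

abbreviation r' :: "nat \<Rightarrow> nat \<Rightarrow> nat" where
  "r' \<equiv> r_tilde s"

lemma r'_sym: "i \<in> {1..n} \<Longrightarrow> j \<in> {1..n} \<Longrightarrow> r' j i = r' i j"
  by (simp add: r_tilde_def sub.num_sym[of i j] eps_def)

text \<open>Two strict inequalities of integers account for the \<open>- 2\<close> in the hypothesis
  on the degrees.\<close>

lemma degree_sum_le_strength:
  assumes "i \<in> {1..n}" "j \<in> {1..n}" "h \<in> {1..n}" "l < s i j" "m < s j h"
  shows "l + m \<le> t j"
  using degrees[OF assms(1-3)] assms(4,5) by (simp add: s_def)

lemma less_degree_le_r_tilde: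
  assumes "l < s i j"
  shows "l \<le> r_tilde r i j"
proof -
  have "s i j \<le> card {1..r i j}" unfolding card_L[symmetric] by (rule card_mono) (auto simp: L_def)
  then show ?thesis using assms by (auto simp: r_tilde_def eps_def)
qed

text \<open>The square of \<open>\<kappa> j\<close> is the inverse of the factor
  \<open>card (Y j) / card (F j)\<close> that \<open>design_product\<close> produces. The same
  scaling turns the normalization in \<open>QB1\<close> for \<open>F\<close> into that for
  \<open>Y\<close>.\<close>

definition \<kappa> :: "nat \<Rightarrow> real" where
  "\<kappa> i = sqrt (real (card (F i)) / real (card (Y i)))"

lemma \<kappa>_nonzero: "i \<in> {1..n} \<Longrightarrow> \<kappa> i \<noteq> 0"
  using Y_nonempty[of i] F_nonempty[of i] by (simp add: \<kappa>_def card_eq_0_iff)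

lemma \<kappa>_square: "\<kappa> i * \<kappa> i = real (card (F i)) / real (card (Y i))"
  by (simp add: \<kappa>_def)

definition H :: "nat \<Rightarrow> nat \<Rightarrow> nat \<Rightarrow> real^'a^'a" where
  "H i j l = (\<kappa> i * \<kappa> j) *\<^sub>R restrict_matrix (Y i) (Y j) (E i j l)"

lemma H_nth:
  "H i j l $ x $ y = (if x \<in> Y i \<and> y \<in> Y j then \<kappa> i * \<kappa> j * E i j l $ x $ y else 0)"
  by (simp add: H_def restrict_matrix_nth)

lemma restrict_in_block:
  assumes ij: "i \<in> {1..n}" "j \<in> {1..n}" and M: "M \<in> block_space r R i j"
  shows "restrict_matrix (Y i) (Y j) M \<in> block_space s S i j"
  using M unfolding block_space_def[of r]
proof (induction rule: span_induct)
  show "subspace {M. restrict_matrix (Y i) (Y j) M \<in> block_space s S i j}"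
    unfolding block_space_def
    using linear_subspace_vimage[OF linear_restrict_matrix subspace_span] by (simp add: vimage_def)
next
  fix M :: "real^'a^'a" assume "M \<in> (\<lambda>l. adjacency_matrix (R i j l)) ` {eps i j..r i j}"
  then obtain l where l: "l \<in> {eps i j..r i j}" "M = adjacency_matrix (R i j l)" by blast
  show "restrict_matrix (Y i) (Y j) M \<in> block_space s S i j"
  proof (cases "R i j l \<inter> (Y i \<times> Y j) = {}")
    case True
    then show ?thesis unfolding l(2) restrict_adjacency_matrix
      by (simp add: adjacency_matrix_def block_space_def span_0 flip: zero_vec_def)
  next
    case False
    then have "l \<in> lab i j ` {eps i j..s i j}"
      using l(1) unfolding bij_betw_imp_surj_on[OF bij_lab[OF ij]] by blast
    then obtain k where k: "k \<in> {eps i j..s i j}" "l = lab i j k" by blast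
    have "restrict_matrix (Y i) (Y j) M = adjacency_matrix (S i j k)"
      unfolding l(2) restrict_adjacency_matrix S_def k(2) by (rule refl)
    then show ?thesis using sub.adjacency_in_block[OF k(1)] by simp
  qed
qed

lemma H_in_block:
  "i \<in> {1..n} \<Longrightarrow> j \<in> {1..n} \<Longrightarrow> l \<le> r_tilde r i j \<Longrightarrow> H i j l \<in> block_space s S i j"
  unfolding H_def using restrict_in_block[OF _ _ E_in_block] by (simp add: block_space_def span_scale)

lemma H_transpose:
  assumes "i \<in> {1..n}" "j \<in> {1..n}" "l \<le> r_tilde r i j"
  shows "transpose (H i j l) = H j i l"
proof -
  have "E j i l $ y $ x = E i j l $ x $ y" for x y
    unfolding E_transpose[OF assms, symmetric] by (simp add: transpose_def)
  then show ?thesis by (simp add: vec_eq_iff transpose_def H_nth)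
qed

text \<open>The middle index runs over \<open>Y j\<close> only, so \<open>design_product\<close>
  evaluates the sum, and the two factors \<open>\<kappa> j\<close> cancel the density of
  \<open>Y j\<close>.\<close>

lemma H_mult:
  assumes ijh: "i \<in> {1..n}" "j \<in> {1..n}" "h \<in> {1..n}"
    and l: "l \<le> r_tilde r i j" and m: "m \<le> r_tilde r j h" and t: "l + m \<le> t j"
  shows "H i j l ** H j h m = (if l = m then H i h l else 0)"
proof -
  have "(H i j l ** H j h m) $ x $ y = (if l = m then H i h l else 0) $ x $ y" for x y
  proof (cases "x \<in> Y i \<and> y \<in> Y h")
    case True
    have "(H i j l ** H j h m) $ x $ y =
        (\<Sum>z\<in>Y j. \<kappa> i * \<kappa> h * (\<kappa> j * \<kappa> j) * (E i j l $ x $ z * E j h m $ z $ y))"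
      unfolding matrix_mul_nth
      by (rule sum.mono_neutral_cong_right) (use True in \<open>auto simp: H_nth algebra_simps\<close>)
    also have "\<dots> = \<kappa> i * \<kappa> h * (\<kappa> j * \<kappa> j) * (\<Sum>z\<in>Y j. E i j l $ x $ z * E j h m $ z $ y)"
      by (simp add: sum_distrib_left)
    also have "\<dots> = (if l = m then \<kappa> i * \<kappa> h * E i h l $ x $ y else 0)"
      unfolding design_product[OF ijh l m design[OF ijh(2)] t] \<kappa>_square
      using Y_nonempty[OF ijh(2)] F_nonempty[OF ijh(2)] by (simp add: card_eq_0_iff)
    finally show ?thesis using True by (simp add: H_nth)
  next
    case False
    then have "(H i j l ** H j h m) $ x $ y = 0" unfolding matrix_mul_nth by (auto simp: H_nth)
    then show ?thesis using False by (cases "l = m") (auto simp: H_nth)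
  qed
  then show ?thesis by (simp add: vec_eq_iff)
qed

text \<open>Diagonal entries at points of \<open>Y i\<close> survive the restriction, and
  \<open>E_diagonal_nonzero\<close> applies to them.\<close>

lemma H_fiber_nonzero:
  assumes i: "i \<in> {1..n}" and k: "k \<le> r_tilde r i i"
  shows "H i i k \<noteq> 0"
proof
  assume 0: "H i i k = 0"
  obtain x where x: "x \<in> Y i" using Y_nonempty[OF i] by blast
  have "E i i k $ x $ x \<noteq> 0"
    using E_diagonal_nonzero[OF i] k Y_subset[OF i] x by (auto simp: r_tilde_fiber)
  then have "H i i k $ x $ x \<noteq> 0" using \<kappa>_nonzero[OF i] x by (simp add: H_nth)
  then show False using 0 by simp
qed

lemma H_nonzero:
  assumes "i \<in> {1..n}" "j \<in> {1..n}" "l \<le> r_tilde r i j" "2 * l \<le> t j"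
  shows "H i j l ** H j i l \<noteq> 0" "H i j l \<noteq> 0"
proof -
  have "H i j l ** H j i l = H i i l"
    using H_mult[OF assms(1,2,1,3), of l] assms r_tilde_sym[OF assms(1,2)] by simp
  then show "H i j l ** H j i l \<noteq> 0"
    using H_fiber_nonzero[OF assms(1), of l] r_tilde_le_fiber[OF assms(1,2)] assms(3) by simp
  then show "H i j l \<noteq> 0" by auto
qed

text \<open>In a fiber the \<open>H i i k\<close> with \<open>k < s i i\<close> are one short of the
  \<open>s i i + 1\<close> relations; the complement of their sum in the identity completes them.
  For \<open>i \<noteq> j\<close> the numbers already agree.\<close>

definition G :: "nat \<Rightarrow> nat \<Rightarrow> nat \<Rightarrow> real^'a^'a" where
  "G i j l = (if i = j \<and> l = s i i then adjacency_matrix (Id_on (Y i)) - (\<Sum>k<s i i. H i i k) else H i j l)"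

section \<open>Dimension counts and admissible indices\<close>

lemma dim_block_le: "i \<in> {1..n} \<Longrightarrow> j \<in> {1..n} \<Longrightarrow> dim (block_space s S i j) \<le> r' i j + 1"
  using sub.dim_block_space[of i j] sub.eps_le_num[of i j] by (simp add: r_tilde_def)

text \<open>Right multiplication by \<open>H h i k\<close> separates \<open>H i h k\<close> from the
  others; the indices in each product add up to at most \<open>2 * l\<close>, within the strength of
  \<open>Y h\<close>.\<close>

lemma H_independent:
  assumes ih: "i \<in> {1..n}" "h \<in> {1..n}" and l: "l \<le> r_tilde r i h" "2 * l \<le> t h"
  shows "inj_on (H i h) {..l}" "independent (H i h ` {..l})"
proof -
  have "\<exists>\<phi> :: real^'a^'a \<Rightarrow> real^'a^'a. linear \<phi> \<and> \<phi> (H i h k) \<noteq> 0 \<and> (\<forall>m\<in>{..l} - {k}. \<phi> (H i h m) = 0)"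
    if k: "k \<in> {..l}" for k
  proof (intro exI conjI ballI)
    show "linear (\<lambda>M :: real^'a^'a. M ** H h i k)" by (rule linear_matrix_mul_right)
    show "H i h k ** H h i k \<noteq> 0" using H_nonzero(1)[OF ih, of k] k l by auto
    fix m assume "m \<in> {..l} - {k}"
    then show "H i h m ** H h i k = 0"
      using H_mult[OF ih ih(1), of m k] k l r_tilde_sym[OF ih] by auto
  qed
  from independent_familyI[OF this] show "inj_on (H i h) {..l}" "independent (H i h ` {..l})" by auto
qed

lemma H_in_block_image:
  "i \<in> {1..n} \<Longrightarrow> h \<in> {1..n} \<Longrightarrow> l \<le> r_tilde r i h \<Longrightarrow> H i h ` {..l} \<subseteq> block_space s S i h"
  using H_in_block by (meson atMost_iff image_subsetI order.trans)

text \<open>There are \<open>l + 1\<close> independent matrices in a space of dimension at most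
  \<open>r' i h + 1\<close>. This supplies the claim in \<open>QB4\<close> that the index of a
  product is in range.\<close>

lemma index_bound:
  assumes ih: "i \<in> {1..n}" "h \<in> {1..n}" and l: "l \<le> r_tilde r i h" "2 * l \<le> t h"
  shows "l \<le> r' i h"
proof -
  have "l + 1 = card (H i h ` {..l})" using H_independent(1)[OF ih l] by (simp add: card_image)
  also have "\<dots> \<le> dim (block_space s S i h)"
    by (rule independent_card_le_dim[OF H_in_block_image[OF ih l(1)] H_independent(2)[OF ih l]])
  finally show ?thesis using dim_block_le[OF ih] by simp
qed

lemma r'_fiber: "r' i i = s i i"
  by (simp add: r_tilde_def eps_def)

lemma Id_in_block: "i \<in> {1..n} \<Longrightarrow> adjacency_matrix (Id_on (Y i)) \<in> block_space s S i i"
  using sub.adjacency_in_block[of 0 i i] sub.rel_diag[of i] by (simp add: eps_def)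

lemma block_mul_Id:
  assumes "i \<in> {1..n}" "j \<in> {1..n}" "M \<in> block_space s S i j"
  shows "M ** adjacency_matrix (Id_on (Y j)) = M"
  by (rule matrix_mul_Id_on) (use sub.block_space_support[OF assms(3,1,2)] in blast)

text \<open>The case at issue is \<open>i = h\<close>, \<open>l = s i i\<close>. If the strength of
  \<open>Y i\<close> reaches \<open>2 * l\<close>, then \<open>H i i 0\<close> to
  \<open>H i i l\<close> are mutually annihilating idempotents that span the block space. So they
  sum to the identity, and the complement used in \<open>G\<close> is \<open>H i i l\<close>
  itself.\<close>

lemma G_eq_H:
  assumes ih: "i \<in> {1..n}" "h \<in> {1..n}" and l: "l \<le> r_tilde r i h" "2 * l \<le> t h"
  shows "G i h l = H i h l"
proof (cases "i = h \<and> l = s i i")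
  case True
  then have l': "l \<le> r_tilde r i i" "2 * l \<le> t i" using l by auto
  have "(\<Sum>k\<le>l. H i i k) = adjacency_matrix (Id_on (Y i))"
  proof (rule sum_orthogonal_idempotents)
    fix k m assume "k \<le> l" "m \<le> l"
    then show "H i i k ** H i i m = (if k = m then H i i k else 0)"
      using l' by (intro H_mult ih) auto
  next
    fix k assume k: "k \<le> l"
    then have k': "k \<le> r_tilde r i i" using l' by simp
    show "H i i k \<noteq> 0" by (rule H_fiber_nonzero[OF ih(1) k'])
    show "H i i k ** adjacency_matrix (Id_on (Y i)) = H i i k"
      by (rule block_mul_Id[OF ih(1,1) H_in_block[OF ih(1,1) k']])
  next
    have "block_space s S i i \<subseteq> span (H i i ` {..l})"
    proof (rule card_ge_dim_independent)
      show "H i i ` {..l} \<subseteq> block_space s S i i" by (rule H_in_block_image[OF ih(1,1) l'(1)])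
      show "independent (H i i ` {..l})" by (rule H_independent(2)[OF ih(1,1) l'])
      show "dim (block_space s S i i) \<le> card (H i i ` {..l})"
        using dim_block_le[OF ih(1,1)] H_independent(1)[OF ih(1,1) l'] True by (simp add: card_image r'_fiber)
    qed
    then show "adjacency_matrix (Id_on (Y i)) \<in> span (H i i ` {..l})" using Id_in_block[OF ih(1)] by blast
  qed
  then have "adjacency_matrix (Id_on (Y i)) = (\<Sum>k<l. H i i k) + H i i l"
    by (simp flip: lessThan_Suc_atMost)
  then show ?thesis using True by (simp add: G_def)
next
  case False
  then show ?thesis unfolding G_def by (simp only: if_False)
qed

lemma G_in_block:
  assumes ij: "i \<in> {1..n}" "j \<in> {1..n}" and l: "l \<le> r' i j"
  shows "G i j l \<in> block_space s S i j"
proof (cases "i = j \<and> l = s i i")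
  case True
  have "H i i k \<in> block_space s S i i" if "k < s i i" for k
    using H_in_block[OF ij(1,1)] less_degree_le_r_tilde[OF that] by blast
  then show ?thesis using True Id_in_block[OF ij(1)]
    unfolding G_def block_space_def by (auto intro!: span_diff span_sum)
next
  case False
  have "l < s i j" using False l sub.eps_le_num[OF ij] by (auto simp: r_tilde_def eps_def split: if_splits)
  then show ?thesis using H_in_block[OF ij less_degree_le_r_tilde] False unfolding G_def by auto
qed

text \<open>Apart from the complementary index, every admissible \<open>l\<close> lies below
  \<open>s i j\<close>; for \<open>i \<noteq> j\<close> this is the shift by
  \<open>eps i j = 1\<close>. The bounds on \<open>2 * l\<close> come from the degree hypothesis for
  the triples \<open>(i, j, i)\<close> and \<open>(j, i, j)\<close>.\<close>

lemma regular_index: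
  assumes "i \<in> {1..n}" "j \<in> {1..n}" "l \<le> r' i j" "\<not> (i = j \<and> l = s i i)"
  shows "l < s i j" "l \<le> r_tilde r i j" "2 * l \<le> t j" "2 * l \<le> t i" "G i j l = H i j l"
proof -
  show l: "l < s i j" using assms sub.eps_le_num[OF assms(1,2)]
    by (auto simp: r_tilde_def eps_def split: if_splits)
  show "l \<le> r_tilde r i j" using l by (rule less_degree_le_r_tilde)
  have l': "l < s j i" using l sub.num_sym[OF assms(1,2)] by simp
  show "2 * l \<le> t j" using degree_sum_le_strength[OF assms(1,2,1) l l'] by simp
  show "2 * l \<le> t i" using degree_sum_le_strength[OF assms(2,1,2) l' l] by simp
  show "G i j l = H i j l" using assms(4) by (auto simp: G_def)
qed

section \<open>Transposes and products of the new basis\<close>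

lemma G_transpose:
  assumes ij: "i \<in> {1..n}" "j \<in> {1..n}" and l: "l \<le> r' i j"
  shows "transpose (G i j l) = G j i l"
proof (cases "i = j \<and> l = s i i")
  case True
  have "H i i k $ x $ y = H i i k $ y $ x" if "k < s i i" for k x y
  proof -
    have "transpose (H i i k) $ x $ y = H i i k $ x $ y"
      using H_transpose[OF ij(1,1) less_degree_le_r_tilde[OF that]] by simp
    then show ?thesis by (simp add: transpose_def)
  qed
  then have "(\<Sum>k<s i i. H i i k $ x $ y) = (\<Sum>k<s i i. H i i k $ y $ x)" for x y
    by (intro sum.cong) auto
  moreover have "(x, y) \<in> Id_on (Y i) \<longleftrightarrow> (y, x) \<in> Id_on (Y i)" for x y by auto
  ultimately show ?thesis using True unfolding G_def
    by (simp add: vec_eq_iff transpose_def adjacency_matrix_def)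
next
  case False
  then show ?thesis using H_transpose[OF ij regular_index(2)[OF ij l]] by (auto simp: G_def)
qed

text \<open>The index \<open>l\<close> need not be below \<open>s i h\<close> in the block of the
  product. Still \<open>index_bound\<close> shows that it is admissible there, and
  \<open>G_eq_H\<close> that the product is the new basis matrix.\<close>

lemma G_mult_regular:
  assumes ijh: "i \<in> {1..n}" "j \<in> {1..n}" "h \<in> {1..n}"
    and l: "l < s i j" and m: "m < s j h"
  shows "H i j l ** H j h m = (if l = m then G i h l else 0)" "l = m \<Longrightarrow> l \<le> r' i h"
proof -
  have l': "l \<le> r_tilde r i j" and m': "m \<le> r_tilde r j h"
    using less_degree_le_r_tilde l m by auto
  have "l \<le> r_tilde r i h \<and> 2 * l \<le> t h" if "l = m"
  proof
    show "l \<le> r_tilde r i h" using r_tilde_trans[OF ijh l'] m' that by simp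
    show "2 * l \<le> t h"
      using degree_sum_le_strength[OF ijh(2,3,2), of l l] m that sub.num_sym[OF ijh(2,3)] by simp
  qed
  then show "l = m \<Longrightarrow> l \<le> r' i h" "H i j l ** H j h m = (if l = m then G i h l else 0)"
    using index_bound[OF ijh(1,3), of l] G_eq_H[OF ijh(1,3), of l]
      H_mult[OF ijh l' m' degree_sum_le_strength[OF ijh l m]] by auto
qed

text \<open>Dimension counting gives \<open>m \<le> s i i\<close>. If \<open>m < s i i\<close>, the
  subtracted summand \<open>H i i m\<close> cancels the contribution of the identity; if
  \<open>m = s i i\<close>, every subtracted summand annihilates \<open>H i h m\<close>.\<close>

lemma G_last_mult_regular:
  assumes ih: "i \<in> {1..n}" "h \<in> {1..n}" and m: "m < s i h"
  shows "G i i (s i i) ** H i h m = (if s i i = m then H i h m else 0)"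
proof -
  have m': "m \<le> r_tilde r i h" by (rule less_degree_le_r_tilde[OF m])
  have "m < s h i" using m sub.num_sym[OF ih] by simp
  then have "2 * m \<le> t i" using degree_sum_le_strength[OF ih(2,1,2) _ m, of m] by simp
  then have bound: "m \<le> s i i"
    using index_bound[OF ih(1,1), of m] r_tilde_le_fiber[OF ih] m' by (simp add: r'_fiber)
  have Id: "adjacency_matrix (Id_on (Y i)) ** H i h m = H i h m"
  proof -
    have "H h i m ** adjacency_matrix (Id_on (Y i)) = H h i m"
      using block_mul_Id[OF ih(2,1) H_in_block[OF ih(2,1)]] m' r_tilde_sym[OF ih] by simp
    then have "transpose (adjacency_matrix (Id_on (Y i)) :: real^'a^'a) ** transpose (H h i m) = transpose (H h i m)"
      by (metis matrix_transpose_mul)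
    moreover have "transpose (adjacency_matrix (Id_on (Y i))) = (adjacency_matrix (Id_on (Y i)) :: real^'a^'a)"
      by (auto simp: transpose_def adjacency_matrix_def vec_eq_iff)
    ultimately show ?thesis using H_transpose[OF ih(2,1), of m] m' r_tilde_sym[OF ih] by simp
  qed
  have "(\<Sum>k<s i i. H i i k) ** H i h m = (\<Sum>k<s i i. H i i k ** H i h m)"
    by (rule linear_sum[OF linear_matrix_mul_right])
  also have "\<dots> = (\<Sum>k<s i i. if k = m then H i h m else 0)"
  proof (rule sum.cong)
    fix k assume "k \<in> {..<s i i}"
    then have k: "k < s i i" by simp
    show "H i i k ** H i h m = (if k = m then H i h m else 0)"
      using H_mult[OF ih(1,1,2) less_degree_le_r_tilde[OF k] m' degree_sum_le_strength[OF ih(1,1,2) k m]] by auto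
  qed simp
  finally have "(\<Sum>k<s i i. H i i k) ** H i h m = (if m < s i i then H i h m else 0)" by simp
  moreover have "G i i (s i i) ** H i h m = H i h m - (\<Sum>k<s i i. H i i k) ** H i h m"
    unfolding G_def using Id by (simp add: linear_diff[OF linear_matrix_mul_right])
  ultimately show ?thesis using bound by simp
qed

lemma G_mult:
  assumes ijh: "i \<in> {1..n}" "j \<in> {1..n}" "h \<in> {1..n}" and l: "l \<le> r' i j" and m: "m \<le> r' j h"
  shows "G i j l ** G j h m = (if l = m then G i h l else 0)" "l = m \<Longrightarrow> l \<le> r' i h"
proof -
  \<comment> \<open>The cases tell which of the two factors is the complementary idempotent of its
    fiber.\<close>
  consider (reg) "\<not> (i = j \<and> l = s i i)" "\<not> (j = h \<and> m = s j j)"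
    | (left) "i = j" "l = s i i" "\<not> (j = h \<and> m = s j j)"
    | (right) "\<not> (i = j \<and> l = s i i)" "j = h" "m = s j j"
    | (both) "i = j" "l = s i i" "j = h" "m = s j j" by blast
  then have "G i j l ** G j h m = (if l = m then G i h l else 0) \<and> (l = m \<longrightarrow> l \<le> r' i h)"
  proof cases
    case reg
    note L = regular_index[OF ijh(1,2) l reg(1)] and M = regular_index[OF ijh(2,3) m reg(2)]
    show ?thesis using G_mult_regular[OF ijh L(1) M(1)] L(5) M(5) by simp
  next
    case left
    note M = regular_index[OF ijh(2,3) m left(3)]
    show ?thesis using G_last_mult_regular[OF ijh(2,3) M(1)] M(5) m left(1,2) by simp
  next
    case right
    note L = regular_index[OF ijh(1,2) l right(1)]
    have l': "l \<le> r' j i" using l r'_sym[OF ijh(1,2)] by simp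
    have "G j i l = H j i l" using right(1) by (auto simp: G_def)
    then have "G j j m ** G j i l = (if m = l then G j i l else 0)"
      using G_last_mult_regular[OF ijh(2,1), of l] L(1) sub.num_sym[OF ijh(1,2)] right(3) by simp
    \<comment> \<open>Transposing turns left multiplication by the complementary idempotent into
      right multiplication.\<close>
    from arg_cong[OF this, of transpose]
    have "transpose (G j i l) ** transpose (G j j m) = (if m = l then transpose (G j i l) else 0)"
      unfolding matrix_transpose_mul by (auto simp: transpose_def zero_vec_def)
    then have "G i j l ** G j j m = (if m = l then G i j l else 0)"
      using G_transpose[OF ijh(2,1) l'] G_transpose[OF ijh(2,2), of m] right(3) by (simp add: r'_fiber)
    then show ?thesis using right(2) l by auto
  next
    case both
    \<comment> \<open>The complementary idempotent annihilates all summands subtracted in its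
      definition, so multiplying it by itself is multiplying it by the identity.\<close>
    have "G i i (s i i) ** H i i k = 0" if "k < s i i" for k
      using G_last_mult_regular[OF ijh(1,1) that] that by simp
    then have "G i i (s i i) ** (\<Sum>k<s i i. H i i k) = 0"
      unfolding linear_sum[OF linear_matrix_mul_left] by simp
    moreover have "G i i (s i i) ** adjacency_matrix (Id_on (Y i)) = G i i (s i i)"
      by (rule block_mul_Id[OF ijh(1,1) G_in_block[OF ijh(1,1)]]) (simp add: r'_fiber)
    moreover have "G i i (s i i) = adjacency_matrix (Id_on (Y i)) - (\<Sum>k<s i i. H i i k)"
      by (simp add: G_def)
    ultimately have "G i i (s i i) ** G i i (s i i) = G i i (s i i)"
      using linear_diff[OF linear_matrix_mul_left[of "G i i (s i i)"]] by (metis diff_zero)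
    then show ?thesis using both l by (simp add: r'_fiber)
  qed
  then show "G i j l ** G j h m = (if l = m then G i h l else 0)" "l = m \<Longrightarrow> l \<le> r' i h" by auto
qed

section \<open>Nonvanishing of the complementary idempotents\<close>

text \<open>Up to the factor \<open>\<kappa> i * \<kappa> i\<close>, the combination is a polynomial
  in the entries of \<open>E i i 1\<close> of degree below \<open>card M\<close>, with a root on
  each relation in \<open>M\<close>. So the polynomial is zero, and its coefficients vanish because
  the degrees of the summands differ.\<close>

lemma H_combination_eq_0:
  assumes i: "i \<in> {1..n}" and K: "finite K" "\<And>k. k \<in> K \<Longrightarrow> k \<le> r i i" "\<And>k. k \<in> K \<Longrightarrow> k < card M"
    and M: "M \<subseteq> {0..r i i}"
    and van: "\<And>l. l \<in> M \<Longrightarrow> \<exists>(x, y)\<in>R i i l \<inter> (Y i \<times> Y i). (\<Sum>k\<in>K. c k *\<^sub>R H i i k) $ x $ y = 0"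
    and k: "k \<in> K"
  shows "c k = 0"
proof -
  have "\<exists>P. \<forall>k\<in>K. P k \<noteq> 0 \<and> degree (P k) = k \<and>
      (\<forall>x\<in>F i. \<forall>y\<in>F i. E i i k $ x $ y = poly (P k) (E i i 1 $ x $ y))"
    using E_poly[OF i i] K(2) by (intro bchoice) (auto simp: r_tilde_fiber)
  then obtain P where P: "\<And>k. k \<in> K \<Longrightarrow> P k \<noteq> 0 \<and> degree (P k) = k"
    and val: "\<And>k x y. k \<in> K \<Longrightarrow> x \<in> F i \<Longrightarrow> y \<in> F i \<Longrightarrow> E i i k $ x $ y = poly (P k) (E i i 1 $ x $ y)"
    by blast
  let ?p = "\<Sum>k\<in>K. smult (c k) (P k)"
  have "?p = 0"
  proof (rule poly_eq_0_of_relations[OF i i])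
    show "M \<subseteq> {eps i i..r i i}" using M by (simp add: eps_def)
    show "degree ?p < card M"
    proof (rule degree_sum_less)
      show "0 < card M" using K(3)[OF k] by simp
      fix m assume m: "m \<in> K"
      have "degree (smult (c m) (P m)) \<le> m" using P[OF m] degree_smult_le[of "c m" "P m"] by simp
      then show "degree (smult (c m) (P m)) < card M" using K(3)[OF m] by simp
    qed
    fix l assume "l \<in> M"
    then obtain x y where xy: "(x, y) \<in> R i i l" "x \<in> Y i" "y \<in> Y i"
      and 0: "(\<Sum>k\<in>K. c k *\<^sub>R H i i k) $ x $ y = 0" using van by blast
    have "x \<in> F i" "y \<in> F i" using xy Y_subset[OF i] by auto
    then have "poly ?p (E i i 1 $ x $ y) = (\<Sum>k\<in>K. c k * E i i k $ x $ y)"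
      unfolding poly_sum poly_smult by (intro sum.cong refl arg_cong2[where f = times] val[symmetric])
    moreover have "(\<Sum>k\<in>K. c k *\<^sub>R H i i k) $ x $ y = \<kappa> i * \<kappa> i * (\<Sum>k\<in>K. c k * E i i k $ x $ y)"
      using xy by (simp add: H_nth sum_distrib_left algebra_simps)
    ultimately have "poly ?p (E i i 1 $ x $ y) = 0" using 0 \<kappa>_nonzero[OF i] by simp
    then show "\<exists>(x, y)\<in>R i i l. poly ?p (E i i 1 $ x $ y) = 0" using xy(1) by blast
  qed
  then show ?thesis using distinct_degrees_independent[OF K(1) P _ k] by blast
qed

lemma s_le_r: "s i i \<le> r i i"
proof -
  have "s i i \<le> card {1..r i i}" unfolding card_L[symmetric] by (rule card_mono) (auto simp: L_def)
  then show ?thesis by simp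
qed

text \<open>Otherwise the sum of the \<open>H i i k\<close> with \<open>k < s i i\<close> would be
  the identity and vanish on all \<open>s i i\<close> nondiagonal relations; its coefficients, all
  1, would have to be 0.\<close>

lemma G_last_nonzero:
  assumes i: "i \<in> {1..n}"
  shows "G i i (s i i) \<noteq> 0"
proof
  assume "G i i (s i i) = 0"
  then have sum: "(\<Sum>k<s i i. 1 *\<^sub>R H i i k) = adjacency_matrix (Id_on (Y i))" by (simp add: G_def)
  obtain x where x: "x \<in> Y i" using Y_nonempty[OF i] by blast
  \<comment> \<open>This makes index 0 available, whose coefficient 1 yields the
    contradiction.\<close>
  have "s i i \<noteq> 0"
  proof
    assume "s i i = 0"
    then have "(adjacency_matrix (Id_on (Y i)) :: real^'a^'a) $ x $ x = 0" using sum by simp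
    then show False using x by (simp add: adjacency_matrix_def Id_on_iff)
  qed
  have "(1::real) = 0"
  proof (rule H_combination_eq_0[OF i, of "{..<s i i}" "L i i" "\<lambda>_. 1" 0])
    show "0 \<in> {..<s i i}" using \<open>s i i \<noteq> 0\<close> by simp
    show "L i i \<subseteq> {0..r i i}" by (auto simp: L_def)
    show "k \<le> r i i" "k < card (L i i)" if "k \<in> {..<s i i}" for k
      using that s_le_r[of i] by (auto simp: card_L)
    fix l assume l: "l \<in> L i i"
    then obtain x y where xy: "(x, y) \<in> R i i l \<inter> (Y i \<times> Y i)" by (auto simp: L_def)
    have "x \<noteq> y"
    proof
      assume "x = y"
      then have "l = 0" using rel_meets_diagonal(2)[OF i i, of l x] l xy by (auto simp: L_def eps_def)
      then show False using l by (simp add: L_def)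
    qed
    then have "(\<Sum>k<s i i. 1 *\<^sub>R H i i k) $ x $ y = 0" unfolding sum by (auto simp: adjacency_matrix_def)
    then show "\<exists>(x, y)\<in>R i i l \<inter> (Y i \<times> Y i). (\<Sum>k<s i i. 1 *\<^sub>R H i i k) $ x $ y = 0" using xy by blast
  qed simp
  then show False by simp
qed

lemma G_nonzero:
  assumes ij: "i \<in> {1..n}" "j \<in> {1..n}" and l: "l \<le> r' i j"
  shows "G i j l \<noteq> 0"
proof (cases "i = j \<and> l = s i i")
  case True
  then show ?thesis using G_last_nonzero[OF ij(1)] by auto
next
  case False
  note reg = regular_index[OF ij l False]
  show ?thesis unfolding reg(5) by (rule H_nonzero(2)[OF ij reg(2,3)])
qed

text \<open>Right multiplication by \<open>G j i k\<close> sends \<open>G i j k\<close> to the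
  nonzero matrix \<open>G i i k\<close> and kills the other members. The number of matrices reaches
  the bound on the dimension, so they also span.\<close>

lemma G_basis:
  assumes ij: "i \<in> {1..n}" "j \<in> {1..n}"
  shows "indexed_basis (G i j) {0..r' i j} (block_space s S i j)"
proof -
  have "\<exists>\<phi> :: real^'a^'a \<Rightarrow> real^'a^'a. linear \<phi> \<and> \<phi> (G i j k) \<noteq> 0 \<and> (\<forall>m\<in>{0..r' i j} - {k}. \<phi> (G i j m) = 0)"
    if k: "k \<in> {0..r' i j}" for k
  proof (intro exI conjI ballI)
    have k': "k \<le> r' i j" "k \<le> r' j i" using k r'_sym[OF ij] by auto
    show "linear (\<lambda>M :: real^'a^'a. M ** G j i k)" by (rule linear_matrix_mul_right)
    show "G i j k ** G j i k \<noteq> 0"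
      using G_mult[OF ij ij(1) k'] G_nonzero[OF ij(1,1), of k] by simp
    fix m assume "m \<in> {0..r' i j} - {k}"
    then show "G i j m ** G j i k = 0" using G_mult(1)[OF ij ij(1) _ k'(2), of m] by auto
  qed
  from independent_familyI[OF this] have inj: "inj_on (G i j) {0..r' i j}"
    and ind: "independent (G i j ` {0..r' i j})" by auto
  have sub: "G i j ` {0..r' i j} \<subseteq> block_space s S i j" using G_in_block[OF ij] by auto
  have "block_space s S i j \<subseteq> span (G i j ` {0..r' i j})"
    by (rule card_ge_dim_independent[OF sub ind]) (use dim_block_le[OF ij] inj in \<open>simp add: card_image\<close>)
  moreover have "span (G i j ` {0..r' i j}) \<subseteq> block_space s S i j"
    by (rule span_minimal[OF sub]) (simp add: block_space_def)
  ultimately show ?thesis using inj ind unfolding indexed_basis_def by blast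
qed

section \<open>The conditions \<open>QB1\<close> to \<open>QB4\<close> for the new basis\<close>

lemma block_mult_eq_0:
  assumes "i \<in> {1..n}" "j \<in> {1..n}" "i' \<in> {1..n}" "h \<in> {1..n}" "j \<noteq> i'"
    and "A \<in> block_space s S i j" "B \<in> block_space s S i' h"
  shows "A ** B = 0"
proof -
  have zero: "A $ x $ z * B $ z $ y = 0" for x y z
  proof (cases "z \<in> Y j")
    case True
    then have "z \<notin> Y i'" using sub.fiber_unique assms by blast
    then show ?thesis using sub.block_space_support[OF assms(7,3,4), of z y] by simp
  next
    case False
    then show ?thesis using sub.block_space_support[OF assms(6,1,2), of x z] by simp
  qed
  have "(A ** B) $ x $ y = 0" for x y
    unfolding matrix_mul_nth by (rule sum.neutral) (use zero in blast)
  then show ?thesis by (simp add: vec_eq_iff)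
qed

sublocale sub: Q_basis n Y s S G
proof
  show "QB1 n Y G"
    unfolding QB1_def
  proof (intro ballI)
    fix i j assume ij: "i \<in> {1..n}" "j \<in> {1..n}"
    have "H i j 0 $ x $ y =
        ((1 / sqrt (real (card (Y i)) * real (card (Y j)))) *\<^sub>R adjacency_matrix (Y i \<times> Y j)) $ x $ y" for x y
    proof (cases "x \<in> Y i \<and> y \<in> Y j")
      case True
      then have "x \<in> F i" "y \<in> F j" using Y_subset ij by auto
      then have "H i j 0 $ x $ y = \<kappa> i * \<kappa> j * (1 / sqrt (real (card (F i)) * real (card (F j))))"
        using True E_0_nth[OF ij] by (simp add: H_nth)
      also have "\<dots> = 1 / sqrt (real (card (Y i)) * real (card (Y j)))"
        using F_nonempty[OF ij(1)] F_nonempty[OF ij(2)]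
        by (simp add: \<kappa>_def real_sqrt_mult real_sqrt_divide card_eq_0_iff)
      finally show ?thesis using True by (simp add: adjacency_matrix_def)
    next
      case False
      then show ?thesis by (auto simp: H_nth adjacency_matrix_def)
    qed
    then have "H i j 0 = (1 / sqrt (real (card (Y i)) * real (card (Y j)))) *\<^sub>R adjacency_matrix (Y i \<times> Y j)"
      unfolding vec_eq_iff by blast
    \<comment> \<open>For \<open>i = j\<close> and \<open>s i i = 0\<close>, \<open>G i i 0\<close>
      is the complement of an empty sum; \<open>G_eq_H\<close> at index 0 covers this case
      too.\<close>
    then show "G i j 0 = (1 / sqrt (real (card (Y i)) * real (card (Y j)))) *\<^sub>R adjacency_matrix (Y i \<times> Y j)"
      using G_eq_H[OF ij, of 0] by simp
  qed
  show "QB2 n s S G" using G_basis by (simp add: QB2_def)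
  show "QB3 n s G" using G_transpose by (simp add: QB3_def)
  show "QB4 n s G"
    unfolding QB4_def
  proof (intro ballI)
    fix i j i' h l m
    assume ij: "i \<in> {1..n}" "j \<in> {1..n}" "i' \<in> {1..n}" "h \<in> {1..n}"
      and lm: "l \<in> {0..r' i j}" "m \<in> {0..r' i' h}"
    then have l: "l \<le> r' i j" and m: "m \<le> r' i' h" by auto
    show "if l = m \<and> j = i' then l \<le> r' i h \<and> G i j l ** G i' h m = G i h l else G i j l ** G i' h m = 0"
    proof (cases "j = i'")
      case True
      then show ?thesis using G_mult[OF ij(1,2,4) l, of m] m by auto
    next
      case False
      then show ?thesis
        using block_mult_eq_0[OF ij False G_in_block[OF ij(1,2) l] G_in_block[OF ij(3,4) m]] by simp
    qed
  qed
qed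

section \<open>The Krein condition for the new basis\<close>

text \<open>Otherwise the last member drops out of the expansion of \<open>H i i (s i i)\<close>,
  which becomes a combination of the \<open>H i i k\<close> with \<open>k < s i i\<close>. The
  difference is zero on all \<open>s i i + 1\<close> relations inside \<open>Y i\<close>, the
  diagonal included, so its leading coefficient 1 would be 0 by
  \<open>H_combination_eq_0\<close>.\<close>

lemma H_last_inner_G_last:
  assumes i: "i \<in> {1..n}" and s: "s i i \<ge> 1"
  shows "H i i (s i i) \<bullet> G i i (s i i) \<noteq> 0"
proof
  let ?s = "s i i"
  assume 0: "H i i ?s \<bullet> G i i ?s = 0"
  have "H i i ?s \<in> block_space s S i i" using H_in_block[OF i i] s_le_r by (simp add: r_tilde_fiber)
  then obtain c where c: "H i i ?s = (\<Sum>k\<le>?s. c k *\<^sub>R G i i k)"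
    using sub.E_expand[OF i i] by (metis r'_fiber)
  have orth: "G i i k \<bullet> G i i ?s = 0" if "k < ?s" for k
    using sub.E_orthogonal[OF i i, of k ?s] that by (simp add: r'_fiber)
  have split: "H i i ?s = (\<Sum>k<?s. c k *\<^sub>R G i i k) + c ?s *\<^sub>R G i i ?s"
    using c by (simp flip: lessThan_Suc_atMost)
  then have "H i i ?s \<bullet> G i i ?s = c ?s * (G i i ?s \<bullet> G i i ?s)"
    by (simp add: inner_add_left inner_sum_left orth)
  then have "c ?s = 0" using 0 G_last_nonzero[OF i] by simp
  then have "H i i ?s = (\<Sum>k<?s. c k *\<^sub>R H i i k)" using split by (simp add: G_def)
  moreover define c' where "c' k = (if k = ?s then 1 else - c k)" for k
  moreover have "(\<Sum>k\<le>?s. c' k *\<^sub>R H i i k) = (\<Sum>k<?s. c' k *\<^sub>R H i i k) + H i i ?s"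
    by (simp add: c'_def flip: lessThan_Suc_atMost)
  moreover have "(\<Sum>k<?s. c' k *\<^sub>R H i i k) = - (\<Sum>k<?s. c k *\<^sub>R H i i k)"
    by (simp add: c'_def flip: sum_negf)
  ultimately have zero: "(\<Sum>k\<le>?s. c' k *\<^sub>R H i i k) = 0" by simp
  have "c' ?s = 0"
  proof (rule H_combination_eq_0[OF i, of "{..?s}" "insert 0 (L i i)" c' ?s])
    have "0 \<notin> L i i" by (simp add: L_def)
    then have card: "card (insert 0 (L i i)) = Suc ?s" using finite_L[of i i] by (simp add: card_L)
    show "k \<le> r i i" "k < card (insert 0 (L i i))" if "k \<in> {..?s}" for k
      using that s_le_r[of i] card by auto
    show "insert 0 (L i i) \<subseteq> {0..r i i}" by (auto simp: L_def)
    fix l assume "l \<in> insert 0 (L i i)"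
    then have "R i i l \<inter> (Y i \<times> Y i) \<noteq> {}"
    proof
      assume "l = 0"
      then show ?thesis unfolding \<open>l = 0\<close> R_restrict_0[OF i] using Y_nonempty[OF i] by auto
    qed (simp add: L_def)
    then obtain x y where "(x, y) \<in> R i i l \<inter> (Y i \<times> Y i)" by auto
    then show "\<exists>(x, y)\<in>R i i l \<inter> (Y i \<times> Y i). (\<Sum>k\<le>?s. c' k *\<^sub>R H i i k) $ x $ y = 0"
      unfolding zero zero_index by blast
  qed simp_all
  then show False by (simp add: c'_def)
qed

text \<open>For \<open>m \<ge> 1\<close> both factors have indices below \<open>r' i j\<close> and
  are rescaled restrictions of old matrices, so the old expansion up to \<open>m + 1\<close> can be
  restricted with them. Its terms with index below \<open>k\<close> are orthogonal to
  \<open>G i j k\<close>; a term with index \<open>k\<close> is not, even if \<open>k\<close> is the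
  complementary index.\<close>

lemma G_hadamard_inner:
  assumes ij: "i \<in> {1..n}" "j \<in> {1..n}" and mk: "m < k" "k \<le> r' i j"
  shows "hadamard (G i j 1) (G i j m) \<bullet> G i j k = 0 \<longleftrightarrow> k \<noteq> m + 1"
\<comment> \<open>If \<open>m = 0\<close>, index 1 may be the complementary one, where
  \<open>G i j 1\<close> need not come from \<open>E i j 1\<close>. Here the factor
  \<open>G i j 0\<close> is constant on the block.\<close>
proof (cases "m = 0")
  case True
  have "hadamard (G i j 1) (G i j 0) = (1 / sqrt (real (card (Y i)) * real (card (Y j)))) *\<^sub>R G i j 1"
    unfolding hadamard_commute[of "G i j 1"]
    by (rule sub.hadamard_E_0[OF ij G_in_block[OF ij]]) (use mk in simp)
  moreover have "1 / sqrt (real (card (Y i)) * real (card (Y j))) \<noteq> 0"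
    using Y_nonempty[OF ij(1)] Y_nonempty[OF ij(2)] by (simp add: card_eq_0_iff)
  ultimately have "hadamard (G i j 1) (G i j m) \<bullet> G i j k = 0 \<longleftrightarrow> G i j 1 \<bullet> G i j k = 0"
    using True by simp
  also have "\<dots> \<longleftrightarrow> k \<noteq> 1"
    using sub.E_orthogonal[OF ij, of 1 k] G_nonzero[OF ij mk(2)] mk by (cases "k = 1") auto
  finally show ?thesis using True by simp
next
  case False
  have regular: "l < s i j \<and> l \<le> r_tilde r i j \<and> G i j l = H i j l" if l: "l < r' i j" for l
  proof -
    have "\<not> (i = j \<and> l = s i i)" using l by (auto simp: r'_fiber)
    from regular_index[OF ij less_imp_le[OF l] this] show ?thesis by blast
  qed
  have m: "m < r' i j" and one: "1 < r' i j" using mk False by auto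
  have r: "m < r_tilde r i j" "1 \<le> r_tilde r i j"
  proof -
    \<comment> \<open>This puts \<open>m + 1\<close> in the range of the old basis, where
      \<open>three_term\<close> guarantees a nonzero coefficient.\<close>
    have "r' i j \<le> r_tilde r i j"
    proof (cases "i = j")
      case True
      then show ?thesis using s_le_r[of i] by (simp add: r'_fiber r_tilde_fiber)
    next
      case False
      then show ?thesis using regular_index(2)[OF ij order.refl] by simp
    qed
    then show "m < r_tilde r i j" "1 \<le> r_tilde r i j" using m one by auto
  qed
  obtain a where a: "hadamard (E i j 1) (E i j m) = (\<Sum>k\<le>min (m + 1) (r_tilde r i j). a k *\<^sub>R E i j k)"
    and a_nz: "a (m + 1) \<noteq> 0"
    using three_term[OF ij _ r(2), of m] r(1) by (metis less_imp_le)
  have min: "min (m + 1) (r_tilde r i j) = Suc m" using r(1) by simp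
  have "hadamard (H i j 1) (H i j m) = (\<kappa> i * \<kappa> j) *\<^sub>R ((\<kappa> i * \<kappa> j) *\<^sub>R restrict_matrix (Y i) (Y j) (hadamard (E i j 1) (E i j m)))"
    (is "?A = ?B")
  proof -
    have "?A $ x $ y = ?B $ x $ y" for x y
    proof (cases "x \<in> Y i \<and> y \<in> Y j")
      case True
      show ?thesis
        unfolding hadamard_def vec_lambda_beta H_nth restrict_matrix_nth vector_scaleR_component
          real_scaleR_def if_P[OF True] by (simp only: mult_ac)
    next
      case False
      show ?thesis
        unfolding hadamard_def vec_lambda_beta H_nth restrict_matrix_nth vector_scaleR_component
          real_scaleR_def if_not_P[OF False] by simp
    qed
    then show ?thesis unfolding vec_eq_iff by blast
  qed
  also have "\<dots> = (\<kappa> i * \<kappa> j) *\<^sub>R (\<Sum>k\<le>Suc m. a k *\<^sub>R H i j k)"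
  proof -
    have "restrict_matrix (Y i) (Y j) (hadamard (E i j 1) (E i j m)) =
        (\<Sum>k\<le>Suc m. a k *\<^sub>R restrict_matrix (Y i) (Y j) (E i j k))"
      unfolding a min linear_sum[OF linear_restrict_matrix] linear_cmul[OF linear_restrict_matrix] by (rule refl)
    then show ?thesis by (simp only: H_def scaleR_sum_right scaleR_scaleR mult_ac)
  qed
  finally have prod: "hadamard (G i j 1) (G i j m) = (\<kappa> i * \<kappa> j) *\<^sub>R (\<Sum>k\<le>Suc m. a k *\<^sub>R H i j k)"
    using regular[OF m] regular[OF one] by simp
  have low: "H i j l \<bullet> G i j k = 0" if "l < k" for l
    using sub.E_orthogonal[OF ij, of l k] regular[of l] that mk(2) by simp
  have top: "H i j k \<bullet> G i j k \<noteq> 0"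
  proof (cases "i = j \<and> k = s i i")
    case True
    then show ?thesis using H_last_inner_G_last[OF ij(1)] mk by auto
  next
    case False
    then show ?thesis using regular_index(5)[OF ij mk(2) False] G_nonzero[OF ij mk(2)] by simp
  qed
  have inner: "hadamard (G i j 1) (G i j m) \<bullet> G i j k = \<kappa> i * \<kappa> j * (a (Suc m) * (H i j (Suc m) \<bullet> G i j k))"
    unfolding prod using low mk(1) by (simp add: inner_sum_left inner_add_left)
  show ?thesis
  proof (cases "k = m + 1")
    case True
    then show ?thesis using inner top a_nz \<kappa>_nonzero ij by simp
  next
    case False
    then show ?thesis using inner low[of "Suc m"] mk(1) by simp
  qed
qed

end

theorem theorem6p2:
  fixes X :: "'a::finite set" and \<R> :: "('a \<times> 'a) set set"
    and n :: nat and F :: "nat \<Rightarrow> 'a set" and r :: "nat \<Rightarrow> nat \<Rightarrow> nat"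
    and R :: "nat \<Rightarrow> nat \<Rightarrow> nat \<Rightarrow> ('a \<times> 'a) set"
    and E :: "nat \<Rightarrow> nat \<Rightarrow> nat \<Rightarrow> real^'a^'a"
    and Y :: "nat \<Rightarrow> 'a set" and t :: "nat \<Rightarrow> nat"
  assumes "Q_polynomial_data X \<R> n F r R E"
    and "\<And>i. i \<in> {1..n} \<Longrightarrow> t_design (F i) (r i i) (E i i) (t i) (Y i)"
    and "\<And>i j h. i \<in> {1..n} \<Longrightarrow> j \<in> {1..n} \<Longrightarrow> h \<in> {1..n} \<Longrightarrow>
           int (degree_between r R Y i j) + int (degree_between r R Y j h) - 2 \<le> int (t j)"
  shows "Q_polynomial_coherent_configuration (\<Union>i\<in>{1..n}. Y i) (induced_relations n r R Y)"
proof -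
  interpret design_family X \<R> n F r R E Y t
    using assms by unfold_locales
  have "Q_polynomial_data (\<Union>i\<in>{1..n}. Y i) sub.relations n Y s S G"
    by (rule sub.Q_polynomial_dataI) (rule G_hadamard_inner)
  then show ?thesis
    unfolding Q_polynomial_coherent_configuration_def relations_eq_induced by blast
qed

end
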